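(* Suppose the system $x(k+1)=A_0x(k)+B_0u(k)+E_0f(k)$, $y(k)=C_0x(k)$ satisfies Assumption 1 with positive integers $r_1,\dots,r_p$, and let $r_{\max}=\max(r_1,\dots,r_p)$ and $f_{\mathrm{new}}(k)=V_0f(k)$. Consider the GMB-ESO $$\hat{\underline{x}}(k+1)=A\hat{\underline{x}}(k)+Bu(k)+L\bigl(y(k)-C\hat{\underline{x}}(k)\bigr),\qquad \hat{\underline{x}}=\begin{bmatrix}\hat x\\ \hat f_{\mathrm{new}}\end{bmatrix},$$ $$\hat f(k)=V_0^{-1}\bigl[\hat f_1^{\mathrm{new}}(k-(r_{\max}-r_1)),\ \dots,\ \hat f_p^{\mathrm{new}}(k-(r_{\max}-r_p))\bigr]^{\top},$$ where $L$ is such that all subsystems of the observer are decoupled and all $r_i+1$ eigenvalues of the $i$-th subsystem are placed at a real number $\omega_{o_i}$ with $|\omega_{o_i}|<1$, $i=1,\dots,p$, and with zero initial observer error ($\hat x(0)=x(0)$, $\hat f_{\mathrm{new}}(0)=f_{\mathrm{new}}(0)$). Then the estimation error of $f$ is $$f(k)-\hat f(k)=V_0^{-1}\operatorname{diag}(h_1^{\mathrm{new}}(k),\dots,h_p^{\mathrm{new}}(k))\ast\Delta f_{\mathrm{new}}(k),$$ i.e. for all $k\ge\max_i(r_{\max}-r_i)$, $f(k)-\hat f(k)=V_0^{-1}\sum_{l=0}^{k-1}\operatorname{diag}(h_1^{\mathrm{new}}(k-l),\dots,h_p^{\mathrm{new}}(k-l))\,\Delta f_{\mathrm{new}}(l)$,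 where $\Delta f_{\mathrm{new}}(k)=f_{\mathrm{new}}(k+1)-f_{\mathrm{new}}(k)$ and $$h_i^{\mathrm{new}}(k)=\begin{cases}1, & 1\le k\le r_{\max}+1,\\[4pt] \displaystyle\sum_{\iota=1}^{r_i+1}\frac{1}{(\iota-1)!}\Bigl(\prod_{j=-\iota+1}^{-1}\bigl(k-(r_{\max}-r_i)+j\bigr)\Bigr)(1-\omega_{o_i})^{\iota-1}\omega_{o_i}^{k-(r_{\max}-r_i)-\iota}, & k\ge r_{\max}+2.\end{cases}$$
   Context: System: $x(k)\in\mathbb{R}^n$, $u(k)\in\mathbb{R}^m$ (known input), $f(k)\in\mathbb{R}^p$ (unknown disturbance), $y(k)\in\mathbb{R}^p$, $k=0,1,2,\dots$; $A_0,B_0,E_0,C_0$ are known real matrices of appropriate sizes; $C_0$ has full row rank. $c_i^0$ is the $i$-th row of $C_0$ and $e_j^0$ the $j$-th column of $E_0$. Convention: an empty product ($\prod_{j=0}^{-1}$) equals $1$. Assumption 1 (with positive integers $r_1,\dots,r_p$): $c_i^0A_0^{\kappa}e_j^0=0$ for all $1\le i,j\le p$ and all integers $0\le\kappa<r_i-1$; $r_1+\cdots+r_p=n$; and the $p\times p$ disturbance gain matrix $V_0$ with $(i,j)$ entry $c_i^0A_0^{r_i-1}e_j^0$ is nonsingular. Augmented matrices: $$A=\begin{bmatrix}A_0&E_0V_0^{-1}\\0_{p\times n}&I_p\end{bmatrix},\quad B=\begin{bmatrix}B_0\\0_{p\times m}\end{bmatrix},\quad C=[C_0,\ 0_{p\times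 p}].$$ Canonical coordinates. The outputs are ordered so that there are real coefficients $a_{ij\kappa}$, with $a_{ij\kappa}=0$ for $\kappa\ge r_j$, such that for $i=1,\dots,p$ $$c_i^0A_0^{r_i}=\sum_{j=1}^p\sum_{\kappa=0}^{r_i-1}a_{ij\kappa}c_j^0A_0^{\kappa}+\sum_{j<i}a_{ijr_i}c_j^0A_0^{r_i}.$$ Put $\bar{\bar c}_i^0=c_i^0-\sum_{j<i}a_{ijr_i}c_j^0$. Then $\bar{\bar c}_i^0A_0^{r_i}=\sum_{j=1}^p\sum_{\kappa=0}^{r_i-1}b_{ij\kappa}\bar{\bar c}_j^0A_0^{\kappa}$ with real coefficients $b_{ij\kappa}$, $b_{ij\kappa}=0$ for $\kappa\ge r_j$. Set $b_{ij\kappa}=0$ also for $\kappa<0$ and $\kappa\ge r_i$, and put $d_{ij\kappa}=b_{ij(\kappa-1)}-b_{ij\kappa}+\delta_{ij}\delta_{\kappa r_i}$ ($\delta$ is the Kronecker delta). Let $S$ be the $(n+p)\times(n+p)$ matrix whose rows are, in order for $i=1,\dots,p$ and, within each $i$, for $\kappa=0,\dots,r_i$, the rows $[\bar{\bar c}_i^0,\ 0_{1\times p}]A^{\kappa}$. Let $Q_1$ be the $(n+p)\times(n+p)$ block matrix with blocks $Q^1_{ij}$ of size $(r_i+1)\times(r_j+1)$ whose $(s,t)$ entry is $\delta_{ij}\delta_{st}-d_{ij,\,r_i+1-s+t}$ if $s>t$, and $\delta_{ij}\delta_{st}$ if $s\le t$. Let $T=Q_1S$ (an invertible matrix). The observer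 has $p$ subsystems, the $i$-th one corresponding to the $i$-th block of $r_i+1$ coordinates of $T\underline{x}$. "All subsystems of the observer are decoupled" means that $T(A-LC)T^{-1}$ is block diagonal with respect to the partition into blocks of sizes $r_1+1,\dots,r_p+1$; the eigenvalues of the $i$-th subsystem are those of its $i$-th diagonal block. *)

theory Defs
  imports
    Complex_Main
    "Jordan_Normal_Form.Gauss_Jordan_Elimination"
    "Jordan_Normal_Form.Spectral_Radius"
    "Jordan_Normal_Form.DL_Rank"
begin

text \<open>All indices start at 0, so \<open>row C0 i\<close> with \<open>i < p\<close> is the \<open>(i+1)\<close>-st output row. For a
  matrix \<open>M\<close> with rows \<open>c\<^sub>i\<close>, the row vector \<open>c\<^sub>i A\<^sup>\<kappa>\<close> is \<open>row (M * A ^\<^sub>m \<kappa>) i\<close>.\<close>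

abbreviation minv :: "real mat \<Rightarrow> real mat" where
  "minv M \<equiv> the (mat_inverse M)"

definition gain_mat :: "nat \<Rightarrow> (nat \<Rightarrow> nat) \<Rightarrow> real mat \<Rightarrow> real mat \<Rightarrow> real mat \<Rightarrow> real mat" where
  "gain_mat p r A0 E0 C0 = mat p p (\<lambda>(i, j). row (C0 * A0 ^\<^sub>m (r i - 1)) i \<bullet> col E0 j)"

definition relative_degree_cond ::
  "nat \<Rightarrow> nat \<Rightarrow> (nat \<Rightarrow> nat) \<Rightarrow> real mat \<Rightarrow> real mat \<Rightarrow> real mat \<Rightarrow> bool" where
  "relative_degree_cond n p r A0 E0 C0 \<longleftrightarrow>
     (\<forall>i<p. 0 < r i) \<and>
     (\<forall>i<p. \<forall>j<p. \<forall>\<kappa><r i - 1. row (C0 * A0 ^\<^sub>m \<kappa>) i \<bullet> col E0 j = 0) \<and>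
     (\<Sum>i<p. r i) = n \<and>
     invertible_mat (gain_mat p r A0 E0 C0)"

definition aug_A :: "nat \<Rightarrow> nat \<Rightarrow> real mat \<Rightarrow> real mat \<Rightarrow> real mat \<Rightarrow> real mat" where
  "aug_A n p A0 E0 V0 = four_block_mat A0 (E0 * minv V0) (0\<^sub>m p n) (1\<^sub>m p)"

definition aug_B :: "nat \<Rightarrow> nat \<Rightarrow> real mat \<Rightarrow> real mat" where
  "aug_B p m B0 = B0 @\<^sub>r 0\<^sub>m p m"

definition aug_C :: "nat \<Rightarrow> real mat \<Rightarrow> real mat" where
  "aug_C p C0 = four_block_mat C0 (0\<^sub>m p p) (0\<^sub>m 0 (dim_col C0)) (0\<^sub>m 0 p)"

definition output_coeffs ::
  "nat \<Rightarrow> nat \<Rightarrow> (nat \<Rightarrow> nat) \<Rightarrow> real mat \<Rightarrow> real mat \<Rightarrow> (nat \<Rightarrow> nat \<Rightarrow> nat \<Rightarrow> real) \<Rightarrow> bool" where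
  "output_coeffs n p r A0 C0 a \<longleftrightarrow>
     (\<forall>i<p. \<forall>j<p. \<forall>\<kappa>\<ge>r j. a i j \<kappa> = 0) \<and>
     (\<forall>i<p. \<forall>q<n.
        row (C0 * A0 ^\<^sub>m r i) i $ q =
          (\<Sum>j<p. \<Sum>\<kappa><r i. a i j \<kappa> * row (C0 * A0 ^\<^sub>m \<kappa>) j $ q)
          + (\<Sum>j<i. a i j (r i) * row (C0 * A0 ^\<^sub>m r i) j $ q))"

definition cbb_mat ::
  "nat \<Rightarrow> nat \<Rightarrow> (nat \<Rightarrow> nat) \<Rightarrow> real mat \<Rightarrow> (nat \<Rightarrow> nat \<Rightarrow> nat \<Rightarrow> real) \<Rightarrow> real mat" where
  "cbb_mat n p r C0 a = mat p n (\<lambda>(i, q). C0 $$ (i, q) - (\<Sum>j<i. a i j (r i) * C0 $$ (j, q)))"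

text \<open>The coefficients vanish outside \<open>\<kappa> < min (r i) (r j)\<close>. Under \<open>relative_degree_cond\<close> the rows
  \<open>c\<^sub>j A0\<^sup>\<kappa>\<close> of the modified output matrix with \<open>\<kappa> < r j\<close> form a basis, so these conditions
  determine \<open>b i j \<kappa>\<close> for \<open>i, j < p\<close>.\<close>

definition canonical_coeffs ::
  "nat \<Rightarrow> nat \<Rightarrow> (nat \<Rightarrow> nat) \<Rightarrow> real mat \<Rightarrow> real mat \<Rightarrow> (nat \<Rightarrow> nat \<Rightarrow> nat \<Rightarrow> real) \<Rightarrow> bool" where
  "canonical_coeffs n p r A0 Cbb b \<longleftrightarrow>
     (\<forall>i<p. \<forall>j<p. \<forall>\<kappa>. r j \<le> \<kappa> \<or> r i \<le> \<kappa> \<longrightarrow> b i j \<kappa> = 0) \<and>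
     (\<forall>i<p. \<forall>q<n.
        row (Cbb * A0 ^\<^sub>m r i) i $ q =
          (\<Sum>j<p. \<Sum>\<kappa><r i. b i j \<kappa> * row (Cbb * A0 ^\<^sub>m \<kappa>) j $ q))"

definition d_coeff ::
  "(nat \<Rightarrow> nat) \<Rightarrow> (nat \<Rightarrow> nat \<Rightarrow> nat \<Rightarrow> real) \<Rightarrow> nat \<Rightarrow> nat \<Rightarrow> nat \<Rightarrow> real" where
  "d_coeff r b i j \<kappa> =
     (if \<kappa> = 0 then 0 else b i j (\<kappa> - 1)) - b i j \<kappa> + (if i = j \<and> \<kappa> = r i then 1 else 0)"

text \<open>Row (or column) number \<open>q\<close> of the block-partitioned \<open>(n+p) \<times> (n+p)\<close> matrices has block index
  \<open>fst (block_index p r ! q)\<close> and position \<open>snd (block_index p r ! q)\<close>, counted from 0, within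
  its block.\<close>

definition block_index :: "nat \<Rightarrow> (nat \<Rightarrow> nat) \<Rightarrow> (nat \<times> nat) list" where
  "block_index p r = concat (map (\<lambda>i. map (\<lambda>s. (i, s)) [0..<r i + 1]) [0..<p])"

definition S_mat ::
  "nat \<Rightarrow> nat \<Rightarrow> (nat \<Rightarrow> nat) \<Rightarrow> real mat \<Rightarrow> real mat \<Rightarrow> real mat" where
  "S_mat n p r A Cbb =
     mat_of_rows (n + p) (map (\<lambda>(i, \<kappa>). row (aug_C p Cbb * A ^\<^sub>m \<kappa>) i) (block_index p r))"

definition Q_mat ::
  "nat \<Rightarrow> nat \<Rightarrow> (nat \<Rightarrow> nat) \<Rightarrow> (nat \<Rightarrow> nat \<Rightarrow> nat \<Rightarrow> real) \<Rightarrow> real mat" where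
  "Q_mat n p r b = mat (n + p) (n + p) (\<lambda>(q1, q2).
     let (i, s) = block_index p r ! q1; (j, t) = block_index p r ! q2
     in (if i = j \<and> s = t then 1 else 0)
        - (if t < s then d_coeff r b i j (r i + 1 + t - s) else 0))"

definition T_mat ::
  "nat \<Rightarrow> nat \<Rightarrow> (nat \<Rightarrow> nat) \<Rightarrow> real mat \<Rightarrow> real mat \<Rightarrow> (nat \<Rightarrow> nat \<Rightarrow> nat \<Rightarrow> real) \<Rightarrow> real mat" where
  "T_mat n p r A Cbb b = Q_mat n p r b * S_mat n p r A Cbb"

text \<open>The list \<open>Ns\<close> contains the diagonal blocks, i.e. the subsystem matrices.\<close>

definition decoupled ::
  "nat \<Rightarrow> (nat \<Rightarrow> nat) \<Rightarrow> real mat \<Rightarrow> real mat \<Rightarrow> real mat \<Rightarrow> real mat \<Rightarrow> real mat list \<Rightarrow> bool" where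
  "decoupled p r A C L T Ns \<longleftrightarrow>
     length Ns = p \<and>
     (\<forall>i<p. Ns ! i \<in> carrier_mat (r i + 1) (r i + 1)) \<and>
     T * (A - L * C) * minv T = diag_block_mat Ns"

text \<open>The spectrum is taken over the complex numbers, so a singleton spectrum means that all
  eigenvalues, counted with multiplicity, coincide.\<close>

definition all_eigenvalues_at :: "real mat \<Rightarrow> real \<Rightarrow> bool" where
  "all_eigenvalues_at N \<omega> \<longleftrightarrow> spectrum (map_mat complex_of_real N) = {complex_of_real \<omega>}"

text \<open>\<open>h_new\<close> is only used for \<open>k \<ge> 1\<close>. In the second branch \<open>k - (rmax - ri) - \<iota> \<ge> 1\<close> whenever
  \<open>ri \<le> rmax\<close>, so the natural-number subtractions there are exact.\<close>

definition h_new :: "nat \<Rightarrow> nat \<Rightarrow> real \<Rightarrow> nat \<Rightarrow> real" where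
  "h_new rmax ri \<omega> k =
     (if k \<le> rmax + 1 then 1
      else (\<Sum>\<iota> = 1..ri + 1.
              1 / fact (\<iota> - 1)
              * (\<Prod>j \<in> {- int \<iota> + 1 .. -1}. real_of_int (int k - (int rmax - int ri) + j))
              * (1 - \<omega>) ^ (\<iota> - 1) * \<omega> ^ (k - (rmax - ri) - \<iota>)))"

end

theory Submission
  imports Defs
begin

text \<open>The rows \<open>t i s\<close> of \<open>T\<close> satisfy three identities: \<open>t i s\<close> times \<open>A ^ q\<close>, applied to a
  disturbance, vanishes for \<open>s + q < r i\<close> and reads off its \<open>i\<close>-th entry for \<open>s + q = r i\<close>; the sum of
  \<open>t i s\<close> over \<open>s\<close> is the coordinate functional of the \<open>i\<close>-th disturbance estimate; and \<open>A\<close> shifts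
  \<open>t i s\<close> to \<open>t i (s + 1)\<close> up to output injection. The first makes \<open>T\<close> invertible. The last forces every
  column but the first of the \<open>i\<close>-th subsystem matrix \<open>N\<close> to be a shift, whatever the gain \<open>L\<close> is. Hence
  the error of the \<open>i\<close>-th disturbance estimate is driven only by the \<open>i\<close>-th disturbance increment, which
  enters at the last coordinate, and its impulse response is \<open>1\<^sup>T N ^ q e\<close> with \<open>e\<close> the last unit vector.
  It equals 1 as long as the impulse is just shifted, that is for \<open>q \<le> r i\<close>. Since \<open>N - \<omega>\<close> is
  nilpotent of index at most \<open>r i + 1\<close>, expanding \<open>N ^ q = (\<omega> + (N - \<omega>)) ^ q\<close> determines the response for
  all \<open>q\<close> from these values: it is the truncated binomial expansion of \<open>(\<omega> + (1 - \<omega>)) ^ q\<close>.\<close>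

section \<open>Block indexing\<close>

lemma block_index_Suc:
  "block_index (Suc p) r = block_index p r @ map (Pair p) [0..<r p + 1]"
  by (simp add: block_index_def)

lemma length_block_index: "length (block_index p r) = (\<Sum>i<p. r i) + p"
proof (induction p)
  case 0 then show ?case by (simp add: block_index_def)
next
  case (Suc p) then show ?case by (simp add: block_index_Suc)
qed

lemma set_block_index: "set (block_index p r) = Sigma {..<p} (\<lambda>i. {..r i})"
  by (auto simp: block_index_def simp del: upt_Suc)

lemma distinct_block_index: "distinct (block_index p r)"
proof (induction p)
  case 0 then show ?case by (simp add: block_index_def)
next
  case (Suc p) then show ?case
    by (auto simp: block_index_Suc set_block_index distinct_map inj_on_def simp del: upt_Suc)
qed

lemma block_index_nth_mem:
  assumes "q < length (block_index p r)" "block_index p r ! q = (i, s)"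
  shows "i < p" "s \<le> r i"
  using nth_mem[OF assms(1)] assms(2) by (auto simp: set_block_index)

lemma block_index_obtain:
  assumes "i < p" "s \<le> r i"
  obtains q where "q < length (block_index p r)" "block_index p r ! q = (i, s)"
proof -
  have "(i, s) \<in> set (block_index p r)" using assms by (simp add: set_block_index)
  then show ?thesis using that by (auto simp: in_set_conv_nth)
qed

text \<open>Converts matrix products over flat row numbers into double sums over blocks and
  positions. The enumeration is a bijection because \<open>block_index\<close> lists every pair
  exactly once.\<close>

lemma sum_block_index:
  fixes g :: "nat \<times> nat \<Rightarrow> 'a :: comm_monoid_add"
  shows "(\<Sum>q<length (block_index p r). g (block_index p r ! q)) = (\<Sum>i<p. \<Sum>s\<le>r i. g (i, s))"
proof -
  have "bij_betw ((!) (block_index p r)) {..<length (block_index p r)} (set (block_index p r))"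
    by (rule bij_betw_nth[OF distinct_block_index]) auto
  from sum.reindex_bij_betw[OF this, of g] show ?thesis
    by (simp add: set_block_index sum.Sigma)
qed

text \<open>Induction on the number of blocks, splitting off the last one, because
  \<open>block_index\<close> also grows at its end. Size and entries are proved together: locating
  an entry of the four-block matrix requires the size of the smaller block diagonal matrix.\<close>

lemma diag_block_mat_index:
  fixes Ns :: "'a :: zero mat list"
  assumes "length Ns = p" "\<And>i. i < p \<Longrightarrow> Ns ! i \<in> carrier_mat (r i + 1) (r i + 1)"
  shows "diag_block_mat Ns \<in> carrier_mat (length (block_index p r)) (length (block_index p r))"
    and "\<lbrakk>q1 < length (block_index p r); q2 < length (block_index p r);
      block_index p r ! q1 = (i, s); block_index p r ! q2 = (j, t)\<rbrakk>
      \<Longrightarrow> diag_block_mat Ns $$ (q1, q2) = (if i = j then Ns ! i $$ (s, t) else 0)"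
proof -
  have "diag_block_mat Ns \<in> carrier_mat (length (block_index p r)) (length (block_index p r)) \<and>
    (\<forall>q1 q2 i s j t. q1 < length (block_index p r) \<longrightarrow> q2 < length (block_index p r) \<longrightarrow>
      block_index p r ! q1 = (i, s) \<longrightarrow> block_index p r ! q2 = (j, t)
      \<longrightarrow> diag_block_mat Ns $$ (q1, q2) = (if i = j then Ns ! i $$ (s, t) else 0))"
    using assms
  proof (induction p arbitrary: Ns)
    case 0
    then show ?case by (simp add: block_index_def)
  next
    case (Suc p)
    define M where "M = butlast Ns"
    define B where "B = last Ns"
    have Ns: "Ns = M @ [B]" and lenM: "length M = p"
      using Suc.prems(1) by (cases Ns rule: rev_cases; auto simp: M_def B_def)+
    have nthM: "Ns ! i = M ! i" if "i < p" for i using that lenM by (simp add: Ns nth_append)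
    have nthB: "Ns ! p = B" by (metis Ns lenM nth_append_length)
    have B: "B \<in> carrier_mat (r p + 1) (r p + 1)" using Suc.prems(2)[of p] nthB by simp
    have Mc: "M ! i \<in> carrier_mat (r i + 1) (r i + 1)" if "i < p" for i
      using Suc.prems(2)[of i] nthM[of i] that by simp
    have IH: "diag_block_mat M \<in> carrier_mat (length (block_index p r)) (length (block_index p r))"
      "\<And>q1 q2 i s j t. \<lbrakk>q1 < length (block_index p r); q2 < length (block_index p r);
        block_index p r ! q1 = (i, s); block_index p r ! q2 = (j, t)\<rbrakk>
        \<Longrightarrow> diag_block_mat M $$ (q1, q2) = (if i = j then M ! i $$ (s, t) else 0)"
      using Suc.IH[OF lenM Mc] by blast+
    define b where "b = length (block_index p r)"
    have D: "diag_block_mat M \<in> carrier_mat b b" using IH(1) by (simp add: b_def)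
    have len: "length (block_index (Suc p) r) = b + (r p + 1)" by (simp add: block_index_Suc b_def)
    have eq: "diag_block_mat Ns = four_block_mat (diag_block_mat M) (0\<^sub>m b (r p + 1)) (0\<^sub>m (r p + 1) b) B"
      using D B by (simp add: Ns diag_block_mat_last Let_def)
    have lo: "block_index (Suc p) r ! q = block_index p r ! q" if "q < b" for q
      using that by (simp add: block_index_Suc b_def nth_append)
    have hi: "block_index (Suc p) r ! q = (p, q - b)" if "\<not> q < b" "q < b + (r p + 1)" for q
      using that by (simp add: block_index_Suc b_def nth_append del: upt_Suc)
    have ne: "fst (block_index p r ! q) < p" if "q < b" for q
      using block_index_nth_mem(1)[of q p r] that by (cases "block_index p r ! q") (auto simp: b_def)
    show ?case
    proof (intro conjI allI impI)
      show "diag_block_mat Ns \<in> carrier_mat (length (block_index (Suc p) r)) (length (block_index (Suc p) r))"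
        unfolding eq len using D B by (intro four_block_carrier_mat) auto
      fix q1 q2 i s j t
      assume q: "q1 < length (block_index (Suc p) r)" "q2 < length (block_index (Suc p) r)"
        and bi: "block_index (Suc p) r ! q1 = (i, s)" "block_index (Suc p) r ! q2 = (j, t)"
      note q' = q[unfolded len]
      have *: "diag_block_mat Ns $$ (q1, q2) =
        (if q1 < b then if q2 < b then diag_block_mat M $$ (q1, q2) else 0
         else if q2 < b then 0 else B $$ (q1 - b, q2 - b))"
        unfolding eq using D B q' by (subst index_mat_four_block) auto
      consider "q1 < b" "q2 < b" | "q1 < b" "\<not> q2 < b" | "\<not> q1 < b" "q2 < b" | "\<not> q1 < b" "\<not> q2 < b"
        by blast
      then show "diag_block_mat Ns $$ (q1, q2) = (if i = j then Ns ! i $$ (s, t) else 0)"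
      proof cases
        case 1
        then have "diag_block_mat M $$ (q1, q2) = (if i = j then M ! i $$ (s, t) else 0)"
          using IH(2)[of q1 q2 i s j t] bi lo by (simp add: b_def)
        then show ?thesis using 1 * nthM[of i] ne[of q1] bi lo[of q1] by auto
      next
        case 2 then show ?thesis using * bi lo[of q1] ne[of q1] hi[of q2] q' by auto
      next
        case 3
        then have "j < p" using bi(2) lo[of q2] ne[of q2] by simp
        then show ?thesis using 3 * bi(1) hi[of q1] q' by auto
      next
        case 4 then show ?thesis using * bi hi[of q1] hi[of q2] q' nthB by auto
      qed
    qed
  qed
  then show "diag_block_mat Ns \<in> carrier_mat (length (block_index p r)) (length (block_index p r))"
    and "\<lbrakk>q1 < length (block_index p r); q2 < length (block_index p r);
      block_index p r ! q1 = (i, s); block_index p r ! q2 = (j, t)\<rbrakk>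
      \<Longrightarrow> diag_block_mat Ns $$ (q1, q2) = (if i = j then Ns ! i $$ (s, t) else 0)"
    by blast+
qed

section \<open>Impulse response of a shift with a single eigenvalue\<close>

text \<open>In the application \<open>H q m\<close> measures an impulse after \<open>m\<close>
  factors \<open>N - \<omega>\<close> and \<open>q\<close> factors \<open>N\<close>, so
  \<open>step\<close> says \<open>N = (N - \<omega>) + \<omega>\<close>. The values
  \<open>H 0 m\<close> with \<open>m \<le> d\<close> can be recovered from the plateau
  \<open>one\<close>, and \<open>nil\<close> removes all later ones.\<close>

lemma binomial_impulse_response:
  fixes H :: "nat \<Rightarrow> nat \<Rightarrow> 'a :: comm_ring_1"
  assumes step: "\<And>q m. H (Suc q) m = H q (Suc m) + \<omega> * H q m"
    and nil: "\<And>m. d < m \<Longrightarrow> H 0 m = 0"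
    and one: "\<And>q. q \<le> d \<Longrightarrow> H q 0 = 1"
    and "d \<le> q"
  shows "H q 0 = (\<Sum>m\<le>d. of_nat (q choose m) * (1 - \<omega>) ^ m * \<omega> ^ (q - m))"
proof -
  \<comment> \<open>On the plateau, \<open>H (Suc q) m - \<omega> * H q m\<close> contributes a
    factor \<open>1 - \<omega>\<close>. Raising \<open>m\<close> by one consumes one time step of
    the plateau, hence the bound on \<open>q + m\<close>.\<close>
  have low: "q + m \<le> d \<Longrightarrow> H q m = (1 - \<omega>) ^ m" for q m
  proof (induction m arbitrary: q)
    case (Suc m)
    have "H q (Suc m) = H (Suc q) m - \<omega> * H q m" by (simp add: step)
    also have "\<dots> = (1 - \<omega>) ^ Suc m" using Suc.prems by (simp add: Suc.IH algebra_simps)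
    finally show ?case .
  qed (simp add: one)
  \<comment> \<open>Binomial expansion in \<open>q\<close> by Pascal's rule; \<open>m\<close> stays
    arbitrary because each step of the recursion trades a unit of \<open>q\<close> for a unit of
    \<open>m\<close>.\<close>
  have expand: "H q m = (\<Sum>j\<le>q. of_nat (q choose j) * \<omega> ^ (q - j) * H 0 (m + j))" for q m
  proof (induction q arbitrary: m)
    case (Suc q)
    have "(\<Sum>j\<le>Suc q. of_nat (Suc q choose j) * \<omega> ^ (Suc q - j) * H 0 (m + j))
      = \<omega> ^ Suc q * H 0 m
        + (\<Sum>j\<le>q. of_nat (Suc q choose Suc j) * \<omega> ^ (q - j) * H 0 (m + Suc j))"
      by (subst sum.atMost_Suc_shift) simp
    also have "\<dots> = (\<Sum>j\<le>q. of_nat (q choose j) * \<omega> ^ (q - j) * H 0 (Suc m + j))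
       + (\<omega> ^ Suc q * H 0 m + (\<Sum>j\<le>q. of_nat (q choose Suc j) * \<omega> ^ (q - j) * H 0 (m + Suc j)))"
      by (simp add: algebra_simps sum.distrib)
    also have "\<omega> ^ Suc q * H 0 m + (\<Sum>j\<le>q. of_nat (q choose Suc j) * \<omega> ^ (q - j) * H 0 (m + Suc j))
      = (\<Sum>j\<le>Suc q. of_nat (q choose j) * \<omega> ^ (Suc q - j) * H 0 (m + j))"
      by (subst sum.atMost_Suc_shift) simp
    also have "\<dots> = \<omega> * (\<Sum>j\<le>q. of_nat (q choose j) * \<omega> ^ (q - j) * H 0 (m + j))"
      unfolding sum_distrib_left
      by (simp add: binomial_eq_0, rule sum.cong) (auto simp: Suc_diff_le algebra_simps)
    finally show ?case by (simp add: step Suc.IH)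
  qed simp
  have "H q 0 = (\<Sum>j\<le>q. of_nat (q choose j) * \<omega> ^ (q - j) * H 0 j)" using expand[of q 0] by simp
  \<comment> \<open>The terms with \<open>j > d\<close> vanish by \<open>nil\<close>;
    \<open>d \<le> q\<close> ensures that none of the remaining terms is missing from the
    expansion.\<close>
  also have "\<dots> = (\<Sum>j\<le>d. of_nat (q choose j) * \<omega> ^ (q - j) * H 0 j)"
    using \<open>d \<le> q\<close> nil by (intro sum.mono_neutral_right) auto
  also have "\<dots> = (\<Sum>m\<le>d. of_nat (q choose m) * (1 - \<omega>) ^ m * \<omega> ^ (q - m))"
    using low[of 0] by (intro sum.cong) (auto simp: algebra_simps)
  finally show ?thesis .
qed

section \<open>Inverses, powers and nilpotent matrices\<close>

lemma minv_det_nonzero: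
  assumes "M \<in> carrier_mat d d" "det M \<noteq> 0"
  shows "minv M \<in> carrier_mat d d" "M * minv M = 1\<^sub>m d" "minv M * M = 1\<^sub>m d"
proof -
  \<comment> \<open>A nonzero determinant excludes the result \<open>None\<close>, so the
    \<open>the\<close> inside \<open>minv\<close> yields a genuine inverse.\<close>
  obtain W where W: "mat_inverse M = Some W"
    using mat_inverse(1)[OF assms(1)] det_non_zero_imp_unit[OF assms] by fastforce
  then show "minv M \<in> carrier_mat d d" "M * minv M = 1\<^sub>m d" "minv M * M = 1\<^sub>m d"
    using mat_inverse(2)[OF assms(1) W] by auto
qed

lemma invertible_mat_det_nonzero:
  fixes M :: "real mat"
  assumes M: "M \<in> carrier_mat d d" and "invertible_mat M"
  shows "det M \<noteq> 0"
proof -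
  obtain W where W: "M * W = 1\<^sub>m d" "W * M = 1\<^sub>m (dim_row W)"
    using assms unfolding invertible_mat_def inverts_mat_def by auto
  \<comment> \<open>\<open>inverts_mat\<close> leaves the shape of \<open>W\<close> open: its column
    count comes from the first product and its row count from the second.\<close>
  have "W \<in> carrier_mat d d"
    using arg_cong[OF W(1), of dim_col] arg_cong[OF W(2), of dim_col] M by auto
  then have "det M * det W = 1" using det_mult[OF M, of W] W(1) by simp
  then show ?thesis by auto
qed

lemma mult_mat_zero_vec:
  fixes M :: "'a :: semiring_0 mat"
  shows "M \<in> carrier_mat nr nc \<Longrightarrow> M *\<^sub>v 0\<^sub>v nc = 0\<^sub>v nr"
  by (intro eq_vecI) (auto simp: scalar_prod_def)

lemma scalar_prod_add_smult:
  fixes w :: "'a :: comm_semiring_0 vec"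
  assumes "w \<in> carrier_vec d" "x \<in> carrier_vec d" "y \<in> carrier_vec d"
  shows "w \<bullet> (x + c \<cdot>\<^sub>v y) = w \<bullet> x + c * (w \<bullet> y)"
  using assms by (simp add: scalar_prod_add_distrib[of _ d])

lemma pow_mat_mult_vec_Suc:
  fixes M :: "'a :: comm_semiring_1 mat"
  assumes "M \<in> carrier_mat d d" "v \<in> carrier_vec d"
  shows "M ^\<^sub>m Suc k *\<^sub>v v = M ^\<^sub>m k *\<^sub>v (M *\<^sub>v v)"
  using assms by (simp add: assoc_mult_mat_vec[of _ d d])

text \<open>The recursion of the matrix power adds the new factor on the right; here it is moved to
  the left.\<close>

lemma pow_mat_mult_vec_commute:
  fixes M :: "'a :: comm_semiring_1 mat"
  assumes M: "M \<in> carrier_mat d d" and v: "v \<in> carrier_vec d"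
  shows "M ^\<^sub>m Suc k *\<^sub>v v = M *\<^sub>v (M ^\<^sub>m k *\<^sub>v v)"
  using v
proof (induction k arbitrary: v)
  case 0 then show ?case using M by simp
next
  case (Suc k)
  have "M ^\<^sub>m Suc (Suc k) *\<^sub>v v = M ^\<^sub>m Suc k *\<^sub>v (M *\<^sub>v v)"
    by (rule pow_mat_mult_vec_Suc[OF M Suc.prems])
  also have "\<dots> = M *\<^sub>v (M ^\<^sub>m k *\<^sub>v (M *\<^sub>v v))"
    using M Suc.prems by (intro Suc.IH) simp
  also have "\<dots> = M *\<^sub>v (M ^\<^sub>m Suc k *\<^sub>v v)"
    by (simp only: pow_mat_mult_vec_Suc[OF M Suc.prems])
  finally show ?case .
qed

text \<open>Each further factor pushes the zero region up by one diagonal.\<close>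

lemma strictly_upper_triangular_pow:
  fixes B :: "'a :: comm_semiring_1 mat"
  assumes B: "B \<in> carrier_mat d d"
    and zero: "\<And>i j. i < d \<Longrightarrow> j \<le> i \<Longrightarrow> B $$ (i, j) = 0"
  shows "\<lbrakk>i < d; j < d; j < i + k\<rbrakk> \<Longrightarrow> (B ^\<^sub>m k) $$ (i, j) = 0"
proof (induction k arbitrary: i j)
  case 0 then show ?case using B by simp
next
  case (Suc k)
  have "(B ^\<^sub>m Suc k) $$ (i, j) = (\<Sum>l = 0..<d. (B ^\<^sub>m k) $$ (i, l) * B $$ (l, j))"
    using B Suc.prems by (simp add: scalar_prod_def)
  also have "\<dots> = 0"
  proof (rule sum.neutral, rule ballI)
    fix l assume "l \<in> {0..<d}"
    then show "(B ^\<^sub>m k) $$ (i, l) * B $$ (l, j) = 0"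
      using Suc.IH[of i l] Suc.prems zero[of l j] by (cases "l < i + k") auto
  qed
  finally show ?case .
qed

text \<open>The shift by \<open>\<omega>\<close> moves the only complex eigenvalue to 0, so a Schur
  form of the shifted matrix is strictly upper triangular and its \<open>d\<close>-th power
  vanishes. The argument runs over the complex numbers, where the characteristic polynomial splits,
  and returns to the reals by injectivity of the embedding.\<close>

lemma all_eigenvalues_at_nilpotent:
  assumes N: "N \<in> carrier_mat d d" and ev: "all_eigenvalues_at N \<omega>"
  shows "(N - \<omega> \<cdot>\<^sub>m 1\<^sub>m d) ^\<^sub>m d = 0\<^sub>m d d"
proof -
  define M where "M = N - \<omega> \<cdot>\<^sub>m 1\<^sub>m d"
  define MC where "MC = map_mat complex_of_real M"
  have M: "M \<in> carrier_mat d d" and MC: "MC \<in> carrier_mat d d"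
    using N by (auto simp: M_def MC_def)
  have NC: "map_mat complex_of_real N = MC + complex_of_real \<omega> \<cdot>\<^sub>m 1\<^sub>m d"
    using N by (intro eq_matI) (auto simp: MC_def M_def)
  have ev0: "k = 0" if k: "eigenvalue MC k" for k
  proof -
    obtain v where v: "v \<in> carrier_vec d" "v \<noteq> 0\<^sub>v d" "MC *\<^sub>v v = k \<cdot>\<^sub>v v"
      using k MC unfolding eigenvalue_def eigenvector_def by auto
    have "map_mat complex_of_real N *\<^sub>v v = MC *\<^sub>v v + (complex_of_real \<omega> \<cdot>\<^sub>m 1\<^sub>m d) *\<^sub>v v"
      unfolding NC using MC v by (intro add_mult_distrib_mat_vec) auto
    also have "\<dots> = (k + complex_of_real \<omega>) \<cdot>\<^sub>v v"
      using v by (intro eq_vecI) (auto simp: algebra_simps)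
    finally have "k + complex_of_real \<omega> \<in> spectrum (map_mat complex_of_real N)"
      using v N unfolding spectrum_def eigenvalue_def eigenvector_def by auto
    then show ?thesis using ev by (simp add: all_eigenvalues_at_def)
  qed
  obtain as where "char_poly MC = (\<Prod>a\<leftarrow>as. [:- a, 1:])"
    using char_poly_factorized[OF MC] by blast
  then obtain B where B: "B \<in> carrier_mat d d" "upper_triangular B" "similar_mat MC B"
    using schur_decomposition_exists[OF MC] by blast
  have cp: "char_poly MC = (\<Prod>a\<leftarrow>diag_mat B. [:- a, 1:])"
    using char_poly_similar[OF B(3)] char_poly_upper_triangular[OF B(1,2)] by simp
  have diag: "B $$ (i, i) = 0" if "i < d" for i
  proof (rule ev0)
    have "B $$ (i, i) \<in> set (diag_mat B)" using that B(1) by (auto simp: diag_mat_def)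
    then have "poly (char_poly MC) (B $$ (i, i)) = 0"
      unfolding cp poly_prod_list prod_list_zero_iff by force
    then show "eigenvalue MC (B $$ (i, i))" by (simp add: eigenvalue_root_char_poly[OF MC])
  qed
  have "(B ^\<^sub>m d) $$ (i, j) = 0" if "i < d" "j < d" for i j
  proof (rule strictly_upper_triangular_pow[OF B(1) _ that])
    fix i j assume "i < d" "j \<le> i"
    then show "B $$ (i, j) = 0" using diag B(1,2) by (cases "j = i") (auto simp: upper_triangular_def)
  qed (use that in simp)
  then have Bd: "B ^\<^sub>m d = 0\<^sub>m d d" using B(1) by (intro eq_matI) auto
  obtain P Q where wit: "similar_mat_wit MC B P Q" using B(3) unfolding similar_mat_def by blast
  note PQ = similar_mat_witD2[OF MC wit]
  have "MC ^\<^sub>m d = 0\<^sub>m d d"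
    unfolding similar_mat_wit_pow_id[OF wit] Bd using PQ(6,7) by simp
  then have "map_mat complex_of_real (M ^\<^sub>m d) = map_mat complex_of_real (0\<^sub>m d d)"
    unfolding MC_def of_real_hom.mat_hom_pow[OF M] by (auto intro: eq_matI)
  then show ?thesis unfolding M_def[symmetric] by (rule of_real_hom.mat_hom_inj)
qed

section \<open>Forced linear recurrences and impulse responses\<close>

lemma linear_recurrence_convolution:
  fixes N :: "'a :: field mat"
  assumes N: "N \<in> carrier_mat d d" and e: "e \<in> carrier_vec d" and w: "w \<in> carrier_vec d"
    and z0: "z 0 = 0\<^sub>v d"
    and step: "\<And>k. z (Suc k) = N *\<^sub>v z k + c k \<cdot>\<^sub>v e"
  shows "w \<bullet> z k = (\<Sum>l<k. c l * (w \<bullet> (N ^\<^sub>m (k - 1 - l) *\<^sub>v e)))"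
proof -
  have z: "z k \<in> carrier_vec d" for k
    by (induction k) (use N e in \<open>auto simp: z0 step\<close>)
  \<comment> \<open>The extra power \<open>N ^ q\<close> makes the induction on \<open>k\<close> go
    through: unfolding \<open>z (Suc k)\<close> turns \<open>q\<close> into \<open>Suc q\<close> on
    the older state.\<close>
  have "w \<bullet> (N ^\<^sub>m q *\<^sub>v z k) = (\<Sum>l<k. c l * (w \<bullet> (N ^\<^sub>m (q + (k - 1 - l)) *\<^sub>v e)))" for q
  proof (induction k arbitrary: q)
    case 0
    have "N ^\<^sub>m q *\<^sub>v 0\<^sub>v d = 0\<^sub>v d" by (rule mult_mat_zero_vec[OF pow_carrier_mat[OF N]])
    then show ?case using w by (simp add: z0)
  next
    case (Suc k)
    have Nq: "N ^\<^sub>m q \<in> carrier_mat d d" using N by simp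
    have "N ^\<^sub>m q *\<^sub>v z (Suc k) = N ^\<^sub>m q *\<^sub>v (N *\<^sub>v z k) + c k \<cdot>\<^sub>v (N ^\<^sub>m q *\<^sub>v e)"
      unfolding step using N e z[of k]
      by (simp add: mult_add_distrib_mat_vec[OF Nq] mult_mat_vec[OF Nq])
    also have "N ^\<^sub>m q *\<^sub>v (N *\<^sub>v z k) = N ^\<^sub>m Suc q *\<^sub>v z k"
      by (rule pow_mat_mult_vec_Suc[OF N z, symmetric])
    finally have "w \<bullet> (N ^\<^sub>m q *\<^sub>v z (Suc k)) = w \<bullet> (N ^\<^sub>m Suc q *\<^sub>v z k) + c k * (w \<bullet> (N ^\<^sub>m q *\<^sub>v e))"
      by (simp only:) (intro scalar_prod_add_smult[OF w] mult_mat_vec_carrier[of _ d d] pow_carrier_mat N z e)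
    also have "w \<bullet> (N ^\<^sub>m Suc q *\<^sub>v z k) = (\<Sum>l<k. c l * (w \<bullet> (N ^\<^sub>m (q + (Suc k - 1 - l)) *\<^sub>v e)))"
    proof (unfold Suc.IH, rule sum.cong)
      fix l assume "l \<in> {..<k}"
      then have "Suc q + (k - 1 - l) = q + (Suc k - 1 - l)" by auto
      then show "c l * (w \<bullet> (N ^\<^sub>m (Suc q + (k - 1 - l)) *\<^sub>v e))
        = c l * (w \<bullet> (N ^\<^sub>m (q + (Suc k - 1 - l)) *\<^sub>v e))" by (simp only:)
    qed simp
    finally show ?case by simp
  qed
  from this[of 0] show ?thesis using N z[of k] by simp
qed

text \<open>The impulse starts at the last coordinate and climbs one coordinate per step, so the sum
  of coordinates stays 1 until it sits at coordinate 0 after \<open>d\<close> steps. From there on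
  the unspecified column 0 acts, and the eigenvalue condition fixes the response.\<close>

lemma shift_impulse_response:
  fixes N :: "real mat"
  assumes N: "N \<in> carrier_mat (d + 1) (d + 1)" and ev: "all_eigenvalues_at N \<omega>"
    and shift: "\<And>s t. \<lbrakk>s \<le> d; 1 \<le> t; t \<le> d\<rbrakk> \<Longrightarrow> N $$ (s, t) = (if s + 1 = t then 1 else 0)"
  defines "resp \<equiv> \<lambda>q. vec (d + 1) (\<lambda>_. 1) \<bullet> (N ^\<^sub>m q *\<^sub>v unit_vec (d + 1) d)"
  shows "q \<le> d \<Longrightarrow> resp q = 1"
    and "d \<le> q \<Longrightarrow> resp q = (\<Sum>m\<le>d. of_nat (q choose m) * (1 - \<omega>) ^ m * \<omega> ^ (q - m))"
proof -
  let ?u = "unit_vec (d + 1) d :: real vec"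
  let ?w = "vec (d + 1) (\<lambda>_. 1) :: real vec"
  define M where "M = N - \<omega> \<cdot>\<^sub>m 1\<^sub>m (d + 1)"
  have M: "M \<in> carrier_mat (d + 1) (d + 1)" unfolding M_def by (intro minus_carrier_mat) simp
  have N_unit: "N *\<^sub>v unit_vec (d + 1) t = unit_vec (d + 1) (t - 1)" if "1 \<le> t" "t \<le> d" for t
  proof (rule eq_vecI)
    fix s assume "s < dim_vec (unit_vec (d + 1) (t - 1) :: real vec)"
    then show "(N *\<^sub>v unit_vec (d + 1) t) $ s = (unit_vec (d + 1) (t - 1) :: real vec) $ s"
      using N that shift[of s t] by (auto simp: scalar_prod_right_unit)
  qed (use N in simp)
  have pow_unit: "q \<le> t \<Longrightarrow> t \<le> d \<Longrightarrow> N ^\<^sub>m q *\<^sub>v unit_vec (d + 1) t = unit_vec (d + 1) (t - q)" for q t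
  proof (induction q arbitrary: t)
    case 0 then show ?case using N by simp
  next
    case (Suc q)
    have "N ^\<^sub>m Suc q *\<^sub>v unit_vec (d + 1) t = N ^\<^sub>m q *\<^sub>v (N *\<^sub>v unit_vec (d + 1) t)"
      by (rule pow_mat_mult_vec_Suc[OF N]) simp
    then show ?case using Suc.prems Suc.IH[of "t - 1"] N_unit[of t] by simp
  qed
  show one: "resp q = 1" if "q \<le> d" for q
    using that pow_unit[of q d] by (simp add: resp_def)
  \<comment> \<open>Separating powers of \<open>N\<close> from powers of
    \<open>M = N - \<omega>\<close> matches the two-index array of
    \<open>binomial_impulse_response\<close>.\<close>
  define H where "H q m = ?w \<bullet> (N ^\<^sub>m q *\<^sub>v (M ^\<^sub>m m *\<^sub>v ?u))" for q m
  have step: "H (Suc q) m = H q (Suc m) + \<omega> * H q m" for q m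
  proof -
    define v where "v = M ^\<^sub>m m *\<^sub>v ?u"
    have v: "v \<in> carrier_vec (d + 1)" 
      unfolding v_def by (rule mult_mat_vec_carrier[OF pow_carrier_mat[OF M]]) simp
    have Nv: "N *\<^sub>v v = M *\<^sub>v v + \<omega> \<cdot>\<^sub>v v"
      unfolding M_def using N v by (subst minus_mult_distrib_mat_vec[of _ "d+1" "d+1"]) auto
    have Mv: "M *\<^sub>v v = M ^\<^sub>m Suc m *\<^sub>v ?u"
      unfolding v_def by (rule pow_mat_mult_vec_commute[OF M, symmetric]) simp
    have Mvc: "M *\<^sub>v v \<in> carrier_vec (d + 1)" by (rule mult_mat_vec_carrier[OF M v])
    have Nq: "N ^\<^sub>m q \<in> carrier_mat (d + 1) (d + 1)" using N by simp
    have "N ^\<^sub>m Suc q *\<^sub>v v = N ^\<^sub>m q *\<^sub>v (M *\<^sub>v v) + \<omega> \<cdot>\<^sub>v (N ^\<^sub>m q *\<^sub>v v)"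
      unfolding pow_mat_mult_vec_Suc[OF N v] Nv using v Mvc
      by (simp add: mult_add_distrib_mat_vec[OF Nq] mult_mat_vec[OF Nq])
    then have "?w \<bullet> (N ^\<^sub>m Suc q *\<^sub>v v) = ?w \<bullet> (N ^\<^sub>m q *\<^sub>v (M *\<^sub>v v)) + \<omega> * (?w \<bullet> (N ^\<^sub>m q *\<^sub>v v))"
      by (simp only:) (intro scalar_prod_add_smult[of _ "d + 1"] mult_mat_vec_carrier[OF Nq] Mvc v vec_carrier)
    then show ?thesis by (simp only: H_def v_def[symmetric] Mv[symmetric])
  qed
  \<comment> \<open>\<open>M\<close> has size \<open>d + 1\<close>, so its power
    \<open>d + 1\<close> is already zero.\<close>
  have nil: "H 0 m = 0" if "d < m" for m
  proof -
    have "M ^\<^sub>m (d + 1 + j) *\<^sub>v ?u = 0\<^sub>v (d + 1)" for j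
    proof (induction j)
      case 0
      have "0\<^sub>m (d + 1) (d + 1) *\<^sub>v ?u = 0\<^sub>v (d + 1)" by (intro eq_vecI) auto
      then show ?case using all_eigenvalues_at_nilpotent[OF N ev] by (simp only: M_def add_0_right)
    next
      case (Suc j)
      then show ?case using pow_mat_mult_vec_commute[OF M, of ?u "d + 1 + j"] mult_mat_zero_vec[OF M]
        by (simp del: pow_mat.simps)
    qed
    from this[of "m - (d + 1)"] show ?thesis 
      using that mult_mat_zero_vec[OF pow_carrier_mat[OF N], of 0] by (simp add: H_def del: pow_mat.simps)
  qed
  have H0: "H q 0 = resp q" for q using N M by (simp add: H_def resp_def)
  show "resp q = (\<Sum>m\<le>d. of_nat (q choose m) * (1 - \<omega>) ^ m * \<omega> ^ (q - m))" if "d \<le> q" for q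
    using binomial_impulse_response[of H \<omega> d q, OF step nil _ that] one by (simp add: H0)
qed

section \<open>The closed form \<open>h_new\<close> as a truncated binomial sum\<close>

lemma prod_shifted_int:
  "(\<Prod>j \<in> {- int \<iota> + 1 .. -1}. real_of_int (int q + 1 + j)) = fact (\<iota> - 1) * real (q choose (\<iota> - 1))"
  if "1 \<le> \<iota>"
proof -
  \<comment> \<open>With \<open>j = -1 - i\<close> the factors become \<open>q - i\<close>, a
    falling factorial of length \<open>\<iota> - 1\<close>.\<close>
  have "(\<Prod>j \<in> {- int \<iota> + 1 .. -1}. real_of_int (int q + 1 + j)) = (\<Prod>i<\<iota> - 1. real q - real i)"
    by (rule prod.reindex_bij_witness[of _ "\<lambda>i. - 1 - int i" "\<lambda>j. nat (- 1 - j)"]) auto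
  also have "\<dots> = fact (\<iota> - 1) * real (q choose (\<iota> - 1))"
    by (simp add: binomial_gbinomial gbinomial_prod_rev atLeast0LessThan)
  finally show ?thesis .
qed

text \<open>Here \<open>q\<close> counts the powers of \<open>N\<close> applied to the impulse. The
  argument adds the alignment delay \<open>rmax - ri\<close> and the one step by which an increment
  enters the next error. The bound \<open>ri + 1 \<le> q\<close> is what selects the second branch
  of \<open>h_new\<close>.\<close>

lemma h_new_shift:
  assumes "ri \<le> rmax" "ri + 1 \<le> q"
  shows "h_new rmax ri \<omega> (q + (rmax - ri) + 1)
    = (\<Sum>m\<le>ri. of_nat (q choose m) * (1 - \<omega>) ^ m * \<omega> ^ (q - m))"
proof -
  have "int (q + (rmax - ri) + 1) - (int rmax - int ri) = int q + 1" using assms by simp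
  moreover have "\<not> q + (rmax - ri) + 1 \<le> rmax + 1" using assms by simp
  ultimately have "h_new rmax ri \<omega> (q + (rmax - ri) + 1) = (\<Sum>\<iota> = 1..ri + 1. 1 / fact (\<iota> - 1)
      * (\<Prod>j \<in> {- int \<iota> + 1 .. -1}. real_of_int (int q + 1 + j))
      * (1 - \<omega>) ^ (\<iota> - 1) * \<omega> ^ (q + (rmax - ri) + 1 - (rmax - ri) - \<iota>))"
    by (simp only: h_new_def if_False)
  also have "\<dots> = (\<Sum>\<iota> = 1..ri + 1. real (q choose (\<iota> - 1)) * (1 - \<omega>) ^ (\<iota> - 1) * \<omega> ^ (q - (\<iota> - 1)))"
  proof (rule sum.cong)
    fix \<iota> assume "\<iota> \<in> {1..ri + 1}"
    then have \<iota>: "1 \<le> \<iota>" and e: "q + (rmax - ri) + 1 - (rmax - ri) - \<iota> = q - (\<iota> - 1)" by auto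
    show "1 / fact (\<iota> - 1) * (\<Prod>j \<in> {- int \<iota> + 1 .. -1}. real_of_int (int q + 1 + j))
        * (1 - \<omega>) ^ (\<iota> - 1) * \<omega> ^ (q + (rmax - ri) + 1 - (rmax - ri) - \<iota>)
      = real (q choose (\<iota> - 1)) * (1 - \<omega>) ^ (\<iota> - 1) * \<omega> ^ (q - (\<iota> - 1))"
      unfolding prod_shifted_int[OF \<iota>] e by simp
  qed simp
  also have "\<dots> = (\<Sum>m\<le>ri. of_nat (q choose m) * (1 - \<omega>) ^ m * \<omega> ^ (q - m))"
    by (rule sum.reindex_bij_witness[of _ "\<lambda>m. m + 1" "\<lambda>\<iota>. \<iota> - 1"]) auto
  finally show ?thesis .
qed

section \<open>Observer canonical form\<close>

locale observer_form =
  fixes n p :: nat and r :: "nat \<Rightarrow> nat"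
    and A0 E0 C0 :: "real mat"
    and a b :: "nat \<Rightarrow> nat \<Rightarrow> nat \<Rightarrow> real"
  assumes A0: "A0 \<in> carrier_mat n n" and E0: "E0 \<in> carrier_mat n p" and C0: "C0 \<in> carrier_mat p n"
    and rel_degree: "relative_degree_cond n p r A0 E0 C0"
    and a_zero: "\<And>i j \<kappa>. \<lbrakk>i < p; j < p; r j \<le> \<kappa>\<rbrakk> \<Longrightarrow> a i j \<kappa> = 0"
    and coeffs_b: "canonical_coeffs n p r A0 (cbb_mat n p r C0 a) b"
begin

abbreviation "V0 \<equiv> gain_mat p r A0 E0 C0"
abbreviation "A \<equiv> aug_A n p A0 E0 V0"
abbreviation "C \<equiv> aug_C p C0"
abbreviation "Cbb \<equiv> cbb_mat n p r C0 a"
abbreviation "T \<equiv> T_mat n p r A Cbb b"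
abbreviation "d \<equiv> d_coeff r b"

text \<open>The rows of \<open>S_mat\<close> as functionals of an augmented state (see
  \<open>S_index\<close>), so that \<open>A\<close> can act on the argument by raising
  \<open>\<kappa>\<close>.\<close>

definition out :: "nat \<Rightarrow> nat \<Rightarrow> real vec \<Rightarrow> real" where
  "out i \<kappa> v = (aug_C p Cbb *\<^sub>v (A ^\<^sub>m \<kappa> *\<^sub>v v)) $ i"

text \<open>The rows of \<open>T_mat\<close> as functionals (see \<open>T_index\<close>). The sum
  over \<open>t\<close> is not cut off at \<open>r j\<close>, since the coefficients beyond that
  position vanish by \<open>d_zero\<close>.\<close>

definition coord :: "nat \<Rightarrow> nat \<Rightarrow> real vec \<Rightarrow> real" where
  "coord i s v = out i s v - (\<Sum>j<p. \<Sum>t<s. d i j (r i + 1 + t - s) * out j t v)"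

section \<open>Coefficients, dimensions and block structure of the augmented system\<close>

lemma r_pos: "i < p \<Longrightarrow> 0 < r i"
  using rel_degree by (simp add: relative_degree_cond_def)

lemma length_index: "length (block_index p r) = n + p"
  using rel_degree by (simp add: relative_degree_cond_def length_block_index)

lemma b_zero: "\<lbrakk>i < p; j < p; r j \<le> \<kappa> \<or> r i \<le> \<kappa>\<rbrakk> \<Longrightarrow> b i j \<kappa> = 0"
  using coeffs_b unfolding canonical_coeffs_def by blast

lemma d_zero: "\<lbrakk>i < p; j < p; r j < \<kappa>\<rbrakk> \<Longrightarrow> d i j \<kappa> = 0"
  using b_zero[of i j \<kappa>] b_zero[of i j "\<kappa> - 1"] Suc_leI[of "r j" \<kappa>]
  by (auto simp: d_coeff_def le_diff_conv2)

lemma V0: "V0 \<in> carrier_mat p p" "det V0 \<noteq> 0"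
proof -
  show V0: "V0 \<in> carrier_mat p p" by (simp add: gain_mat_def)
  show "det V0 \<noteq> 0"
    using rel_degree by (intro invertible_mat_det_nonzero[OF V0]) (simp add: relative_degree_cond_def)
qed

lemmas minv_V0 = minv_det_nonzero[OF V0]

lemma A: "A \<in> carrier_mat (n + p) (n + p)"
  using A0 by (simp add: aug_A_def)

lemma Cbb: "Cbb \<in> carrier_mat p n"
  by (simp add: cbb_mat_def)

lemma aug_C: "M \<in> carrier_mat p n \<Longrightarrow> aug_C p M \<in> carrier_mat p (n + p)"
  by (auto simp: aug_C_def)

lemma aug_C_append:
  assumes "M \<in> carrier_mat p n" "x \<in> carrier_vec n" "w \<in> carrier_vec p"
  shows "aug_C p M *\<^sub>v (x @\<^sub>v w) = M *\<^sub>v x"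
proof -
  have "aug_C p M *\<^sub>v (x @\<^sub>v w) =
      (M *\<^sub>v x + 0\<^sub>m p p *\<^sub>v w) @\<^sub>v (0\<^sub>m 0 (dim_col M) *\<^sub>v x + 0\<^sub>m 0 p *\<^sub>v w)"
    unfolding aug_C_def using assms by (intro four_block_mat_mult_vec[of _ p n _ p _ 0]) auto
  also have "\<dots> = M *\<^sub>v x" using assms by (intro eq_vecI) auto
  finally show ?thesis .
qed

lemma A_append:
  assumes "x \<in> carrier_vec n" "w \<in> carrier_vec p"
  shows "A *\<^sub>v (x @\<^sub>v w) = (A0 *\<^sub>v x + E0 *\<^sub>v (minv V0 *\<^sub>v w)) @\<^sub>v w"
proof -
  have "A *\<^sub>v (x @\<^sub>v w) =
      (A0 *\<^sub>v x + (E0 * minv V0) *\<^sub>v w) @\<^sub>v (0\<^sub>m p n *\<^sub>v x + 1\<^sub>m p *\<^sub>v w)"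
    unfolding aug_A_def using assms A0 E0 minv_V0 by (intro four_block_mat_mult_vec) auto
  also have "(E0 * minv V0) *\<^sub>v w = E0 *\<^sub>v (minv V0 *\<^sub>v w)"
    using assms E0 minv_V0(1) by (rule_tac assoc_mult_mat_vec)
  also have "0\<^sub>m p n *\<^sub>v x + 1\<^sub>m p *\<^sub>v w = w" using assms by (intro eq_vecI) auto
  finally show ?thesis .
qed

lemma A_last:
  assumes "v \<in> carrier_vec (n + p)" "i < p"
  shows "(A *\<^sub>v v) $ (n + i) = v $ (n + i)"
proof -
  have "(A *\<^sub>v (vec_first v n @\<^sub>v vec_last v p)) $ (n + i) = (vec_first v n @\<^sub>v vec_last v p) $ (n + i)"
    using A0 E0 assms(2) by (subst A_append) auto
  then show ?thesis using assms(1) by simp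
qed

lemma A_pow: "A ^\<^sub>m k \<in> carrier_mat (n + p) (n + p)"
  using A by simp

lemma A_pow_vec: "v \<in> carrier_vec (n + p) \<Longrightarrow> A ^\<^sub>m k *\<^sub>v v \<in> carrier_vec (n + p)"
  by (rule mult_mat_vec_carrier[OF A_pow])

section \<open>Output functionals along the augmented dynamics\<close>

lemma out_add:
  assumes "v \<in> carrier_vec (n + p)" "w \<in> carrier_vec (n + p)" "i < p"
  shows "out i \<kappa> (v + w) = out i \<kappa> v + out i \<kappa> w"
  unfolding out_def mult_add_distrib_mat_vec[OF A_pow assms(1,2)]
  using mult_add_distrib_mat_vec[OF aug_C[OF Cbb] A_pow_vec[OF assms(1)] A_pow_vec[OF assms(2)], of \<kappa> \<kappa>]
    assms(3) aug_C[OF Cbb] by (simp del: index_mult_mat_vec)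

lemma out_mult: "v \<in> carrier_vec (n + p) \<Longrightarrow> out i \<kappa> (A *\<^sub>v v) = out i (Suc \<kappa>) v"
  unfolding out_def by (simp only: pow_mat_mult_vec_Suc[OF A])

lemma out_pow: "v \<in> carrier_vec (n + p) \<Longrightarrow> out i \<kappa> (A ^\<^sub>m q *\<^sub>v v) = out i (\<kappa> + q) v"
proof (induction q arbitrary: \<kappa>)
  case 0 then show ?case using A by simp
next
  case (Suc q)
  then show ?case
    using out_mult[OF A_pow_vec[OF Suc.prems], of i \<kappa> q] Suc.IH[OF Suc.prems, of "Suc \<kappa>"]
    by (simp only: pow_mat_mult_vec_commute[OF A Suc.prems]) simp
qed

text \<open>With zero disturbance part the augmented dynamics reduce to those of the plant.\<close>

lemma out_append_zero:
  assumes "x \<in> carrier_vec n"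
  shows "out i \<kappa> (x @\<^sub>v 0\<^sub>v p) = (Cbb *\<^sub>v (A0 ^\<^sub>m \<kappa> *\<^sub>v x)) $ i"
  using assms
proof (induction \<kappa> arbitrary: x)
  case 0
  then show ?case using A A0 by (simp add: out_def aug_C_append[OF Cbb] del: index_mult_mat_vec)
next
  case (Suc \<kappa>)
  have "minv V0 *\<^sub>v 0\<^sub>v p = 0\<^sub>v p" "E0 *\<^sub>v 0\<^sub>v p = 0\<^sub>v n"
    by (simp_all only: mult_mat_zero_vec[OF minv_V0(1)] mult_mat_zero_vec[OF E0])
  then have "A *\<^sub>v (x @\<^sub>v 0\<^sub>v p) = (A0 *\<^sub>v x) @\<^sub>v 0\<^sub>v p"
    using A_append[OF Suc.prems, of "0\<^sub>v p"] A0 Suc.prems by simp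
  then have "out i (Suc \<kappa>) (x @\<^sub>v 0\<^sub>v p) = out i \<kappa> ((A0 *\<^sub>v x) @\<^sub>v 0\<^sub>v p)"
    using out_mult[of "x @\<^sub>v 0\<^sub>v p" i \<kappa>] Suc.prems by simp
  then show ?case using Suc.IH[of "A0 *\<^sub>v x"] A0 Suc.prems pow_mat_mult_vec_Suc[OF A0 Suc.prems, of \<kappa>]
    by simp
qed

lemma out_0: "v \<in> carrier_vec (n + p) \<Longrightarrow> out i 0 v = (aug_C p Cbb *\<^sub>v v) $ i"
  using A by (simp add: out_def)

lemma Cbb_mult:
  assumes "x \<in> carrier_vec n" "i < p"
  shows "(Cbb *\<^sub>v x) $ i = (C0 *\<^sub>v x) $ i - (\<Sum>j<i. a i j (r i) * (C0 *\<^sub>v x) $ j)"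
proof -
  have "(Cbb *\<^sub>v x) $ i = (\<Sum>q = 0..<n. (C0 $$ (i, q) - (\<Sum>j<i. a i j (r i) * C0 $$ (j, q))) * x $ q)"
    using assms by (simp add: cbb_mat_def scalar_prod_def)
  also have "\<dots> = (\<Sum>q = 0..<n. C0 $$ (i, q) * x $ q)
      - (\<Sum>q = 0..<n. \<Sum>j<i. a i j (r i) * (C0 $$ (j, q) * x $ q))"
    by (simp add: left_diff_distrib sum_subtractf sum_distrib_right mult.assoc)
  also have "(\<Sum>q = 0..<n. \<Sum>j<i. a i j (r i) * (C0 $$ (j, q) * x $ q))
      = (\<Sum>j<i. a i j (r i) * (\<Sum>q = 0..<n. C0 $$ (j, q) * x $ q))"
    by (subst sum.swap) (simp add: sum_distrib_left)
  finally show ?thesis using assms C0 by (simp add: scalar_prod_def)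
qed

lemma C0_gain:
  assumes w: "w \<in> carrier_vec p" and i: "i < p"
  shows "q < r i - 1 \<Longrightarrow> (C0 *\<^sub>v (A0 ^\<^sub>m q *\<^sub>v (E0 *\<^sub>v w))) $ i = 0"
    and "(C0 *\<^sub>v (A0 ^\<^sub>m (r i - 1) *\<^sub>v (E0 *\<^sub>v w))) $ i = (V0 *\<^sub>v w) $ i"
proof -
  have *: "(C0 *\<^sub>v (A0 ^\<^sub>m q *\<^sub>v (E0 *\<^sub>v w))) $ i = (\<Sum>j<p. (row (C0 * A0 ^\<^sub>m q) i \<bullet> col E0 j) * w $ j)" for q
  proof -
    have Ew: "E0 *\<^sub>v w \<in> carrier_vec n" and Aq: "A0 ^\<^sub>m q \<in> carrier_mat n n" using A0 E0 w by simp_all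
    have "C0 *\<^sub>v (A0 ^\<^sub>m q *\<^sub>v (E0 *\<^sub>v w)) = (C0 * A0 ^\<^sub>m q * E0) *\<^sub>v w"
      using assoc_mult_mat_vec[OF C0 Aq Ew] assoc_mult_mat_vec[OF mult_carrier_mat[OF C0 Aq] E0 w] by simp
    moreover have "((M * E0) *\<^sub>v w) $ i = (\<Sum>j<p. (row M i \<bullet> col E0 j) * w $ j)"
      if "M \<in> carrier_mat p n" for M
      using that E0 w i by (simp add: scalar_prod_def[of _ w] lessThan_atLeast0 del: assoc_mult_mat_vec)
    ultimately show ?thesis using mult_carrier_mat[OF C0 Aq] by simp
  qed
  show "(C0 *\<^sub>v (A0 ^\<^sub>m q *\<^sub>v (E0 *\<^sub>v w))) $ i = 0" if "q < r i - 1"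
    unfolding * using rel_degree that i by (simp add: relative_degree_cond_def)
  show "(C0 *\<^sub>v (A0 ^\<^sub>m (r i - 1) *\<^sub>v (E0 *\<^sub>v w))) $ i = (V0 *\<^sub>v w) $ i"
    unfolding * using i w by (simp add: gain_mat_def scalar_prod_def[of _ w] lessThan_atLeast0)
qed

text \<open>A correction term with \<open>a i j (r i) \<noteq> 0\<close> has \<open>r i < r j\<close>, so output \<open>j\<close> has not yet responded;
  hence the modified outputs keep the gain matrix.\<close>

lemma Cbb_gain:
  assumes w: "w \<in> carrier_vec p" and i: "i < p" and q: "q < r i"
  shows "(Cbb *\<^sub>v (A0 ^\<^sub>m q *\<^sub>v (E0 *\<^sub>v (minv V0 *\<^sub>v w)))) $ i = (if Suc q = r i then w $ i else 0)"
proof -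
  let ?w = "minv V0 *\<^sub>v w"
  let ?x = "A0 ^\<^sub>m q *\<^sub>v (E0 *\<^sub>v ?w)"
  have w': "?w \<in> carrier_vec p" by (rule mult_mat_vec_carrier[OF minv_V0(1) w])
  have x: "?x \<in> carrier_vec n"
    by (rule mult_mat_vec_carrier[OF pow_carrier_mat[OF A0] mult_mat_vec_carrier[OF E0 w']])
  \<comment> \<open>The factor \<open>minv V0\<close> built into \<open>aug_A\<close> cancels the
    gain matrix, so each output sees its own disturbance with unit gain.\<close>
  have V0w: "V0 *\<^sub>v ?w = w"
    using assoc_mult_mat_vec[OF V0(1) minv_V0(1) w] w by (simp only: minv_V0(2) one_mult_mat_vec)
  have C0x: "(C0 *\<^sub>v ?x) $ i = (if Suc q = r i then w $ i else 0)"
  proof (cases "Suc q = r i")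
    case True
    then have "q = r i - 1" by simp
    then show ?thesis using C0_gain(2)[OF w' i] True V0w by (simp only: if_True refl)
  next
    case False
    then show ?thesis using C0_gain(1)[OF w' i, of q] q by (simp del: index_mult_mat_vec)
  qed
  have corr: "a i j (r i) * (C0 *\<^sub>v ?x) $ j = 0" if "j < i" for j
  proof (cases "r j \<le> r i")
    case True then show ?thesis using a_zero[of i j] that i by simp
  next
    case False
    then show ?thesis using C0_gain(1)[OF w', of j q] that i q by simp
  qed
  have "(\<Sum>j<i. a i j (r i) * (C0 *\<^sub>v ?x) $ j) = 0"
    by (intro sum.neutral ballI corr) simp
  then show ?thesis unfolding Cbb_mult[OF x i] C0x by simp
qed

text \<open>A disturbance held constant feeds one more impulse into the plant at every step. By
  \<open>Cbb_gain\<close> the first to reach output \<open>i\<close> does so exactly at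
  \<open>\<kappa> = r i\<close>.\<close>

lemma out_zero_append:
  assumes w: "w \<in> carrier_vec p" and i: "i < p"
  shows "\<kappa> \<le> r i \<Longrightarrow> out i \<kappa> (0\<^sub>v n @\<^sub>v w) = (if \<kappa> = r i then w $ i else 0)"
proof (induction \<kappa>)
  case 0
  have "out i 0 (0\<^sub>v n @\<^sub>v w) = (Cbb *\<^sub>v 0\<^sub>v n) $ i"
    using w by (simp add: out_0 aug_C_append[OF Cbb] del: index_mult_mat_vec)
  then show ?case using r_pos[OF i] i by (simp only: mult_mat_zero_vec[OF Cbb]) simp
next
  case (Suc \<kappa>)
  let ?x = "E0 *\<^sub>v (minv V0 *\<^sub>v w)"
  have x: "?x \<in> carrier_vec n"
    by (rule mult_mat_vec_carrier[OF E0 mult_mat_vec_carrier[OF minv_V0(1) w]])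
  have "A *\<^sub>v (0\<^sub>v n @\<^sub>v w) = ?x @\<^sub>v w"
    using A_append[of "0\<^sub>v n" w] mult_mat_zero_vec[OF A0] w x by simp
  also have "\<dots> = (?x @\<^sub>v 0\<^sub>v p) + (0\<^sub>v n @\<^sub>v w)"
    using x w by (subst append_vec_add[of _ n _ _ p]) auto
  finally have "out i (Suc \<kappa>) (0\<^sub>v n @\<^sub>v w) = out i \<kappa> (?x @\<^sub>v 0\<^sub>v p) + out i \<kappa> (0\<^sub>v n @\<^sub>v w)"
    using out_mult[of "0\<^sub>v n @\<^sub>v w" i \<kappa>] w x i by (simp add: out_add)
  then show ?case using Suc out_append_zero[OF x, of i \<kappa>] Cbb_gain[OF w i, of \<kappa>] by auto
qed

text \<open>The canonical relation of the plant, extended by the contribution of the disturbance; it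
  recovers the \<open>i\<close>-th disturbance from outputs.\<close>

lemma out_r:
  assumes v: "v \<in> carrier_vec (n + p)" and i: "i < p"
  shows "out i (r i) v = (\<Sum>j<p. \<Sum>\<kappa><r i. b i j \<kappa> * out j \<kappa> v) + v $ (n + i)"
proof -
  define x w where "x = vec_first v n" and "w = vec_last v p"
  have x: "x \<in> carrier_vec n" and w: "w \<in> carrier_vec p" by (auto simp: x_def w_def)
  have vxw: "v = (x @\<^sub>v 0\<^sub>v p) + (0\<^sub>v n @\<^sub>v w)"
    using v x w by (subst append_vec_add[of _ n _ _ p]) (auto simp: x_def w_def)
  have split: "out j \<kappa> v = out j \<kappa> (x @\<^sub>v 0\<^sub>v p) + out j \<kappa> (0\<^sub>v n @\<^sub>v w)" if "j < p" for j \<kappa>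
    unfolding vxw using x w that by (intro out_add) auto
  have row_x: "out j \<kappa> (x @\<^sub>v 0\<^sub>v p) = (\<Sum>q<n. row (Cbb * A0 ^\<^sub>m \<kappa>) j $ q * x $ q)" if "j < p" for j \<kappa>
  proof -
    have "out j \<kappa> (x @\<^sub>v 0\<^sub>v p) = ((Cbb * A0 ^\<^sub>m \<kappa>) *\<^sub>v x) $ j"
      using out_append_zero[OF x, of j \<kappa>] assoc_mult_mat_vec[OF Cbb pow_carrier_mat[OF A0] x, of \<kappa>] by simp
    also have "\<dots> = row (Cbb * A0 ^\<^sub>m \<kappa>) j \<bullet> x" using that Cbb by simp
    also have "\<dots> = (\<Sum>q<n. row (Cbb * A0 ^\<^sub>m \<kappa>) j $ q * x $ q)"
      using x by (simp only: scalar_prod_def lessThan_atLeast0 carrier_vecD)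
    finally show ?thesis .
  qed
  have coeffs: "row (Cbb * A0 ^\<^sub>m r i) i $ q =
      (\<Sum>j<p. \<Sum>\<kappa><r i. b i j \<kappa> * row (Cbb * A0 ^\<^sub>m \<kappa>) j $ q)" if "q < n" for q
    using coeffs_b i that unfolding canonical_coeffs_def by blast
  have "out i (r i) (x @\<^sub>v 0\<^sub>v p)
      = (\<Sum>q<n. \<Sum>j<p. \<Sum>\<kappa><r i. b i j \<kappa> * (row (Cbb * A0 ^\<^sub>m \<kappa>) j $ q * x $ q))"
    unfolding row_x[OF i]
    by (intro sum.cong refl) (simp add: coeffs sum_distrib_right mult.assoc del: index_row)
  also have "\<dots> = (\<Sum>j<p. \<Sum>\<kappa><r i. \<Sum>q<n. b i j \<kappa> * (row (Cbb * A0 ^\<^sub>m \<kappa>) j $ q * x $ q))"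
    by (subst sum.swap) (rule sum.cong[OF refl], rule sum.swap)
  also have "\<dots> = (\<Sum>j<p. \<Sum>\<kappa><r i. b i j \<kappa> * out j \<kappa> (x @\<^sub>v 0\<^sub>v p))"
    by (intro sum.cong refl) (simp add: row_x sum_distrib_left del: index_row)
  \<comment> \<open>The plant part may be replaced by the full state: for
    \<open>\<kappa> < r j\<close> output \<open>j\<close> does not see the disturbance yet, and
    otherwise \<open>b i j \<kappa> = 0\<close>.\<close>
  also have "\<dots> = (\<Sum>j<p. \<Sum>\<kappa><r i. b i j \<kappa> * out j \<kappa> v)"
  proof (intro sum.cong refl)
    fix j \<kappa> assume "j \<in> {..<p}" "\<kappa> \<in> {..<r i}"
    then show "b i j \<kappa> * out j \<kappa> (x @\<^sub>v 0\<^sub>v p) = b i j \<kappa> * out j \<kappa> v"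
      using out_zero_append[OF w, of j \<kappa>] b_zero[of i j \<kappa>] i by (cases "\<kappa> < r j") (auto simp: split)
  qed
  finally show ?thesis
    using split[OF i, of "r i"] out_zero_append[OF w i, of "r i"] v i
    by (simp add: w_def vec_last_def)
qed

text \<open>\<open>A\<close> keeps the disturbance part constant, so subtracting
  \<open>out_r\<close> at \<open>v\<close> from \<open>out_r\<close> at \<open>A v\<close>
  eliminates it. This differencing is the origin of the coefficients \<open>d_coeff\<close>.\<close>

lemma out_Suc_r:
  assumes v: "v \<in> carrier_vec (n + p)" and i: "i < p"
  shows "out i (Suc (r i)) v = (\<Sum>j<p. \<Sum>\<kappa><Suc (r i). d i j \<kappa> * out j \<kappa> v)"
proof -
  have Av: "A *\<^sub>v v \<in> carrier_vec (n + p)" by (rule mult_mat_vec_carrier[OF A v])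
  have d_sum: "(\<Sum>\<kappa><Suc (r i). d i j \<kappa> * out j \<kappa> v) =
      (\<Sum>\<kappa><r i. b i j \<kappa> * out j (Suc \<kappa>) v) - (\<Sum>\<kappa><r i. b i j \<kappa> * out j \<kappa> v)
      + (if i = j then out i (r i) v else 0)" if j: "j < p" for j
  proof -
    have "(\<Sum>\<kappa><Suc (r i). d i j \<kappa> * out j \<kappa> v) =
        (\<Sum>\<kappa><Suc (r i). (if \<kappa> = 0 then 0 else b i j (\<kappa> - 1)) * out j \<kappa> v)
        - (\<Sum>\<kappa><Suc (r i). b i j \<kappa> * out j \<kappa> v)
        + (\<Sum>\<kappa><Suc (r i). if \<kappa> = r i then (if i = j then out j \<kappa> v else 0) else 0)"
      unfolding sum_subtractf[symmetric] sum.distrib[symmetric]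
      by (intro sum.cong refl) (auto simp: d_coeff_def algebra_simps)
    also have "(\<Sum>\<kappa><Suc (r i). (if \<kappa> = 0 then 0 else b i j (\<kappa> - 1)) * out j \<kappa> v)
        = (\<Sum>\<kappa><r i. b i j \<kappa> * out j (Suc \<kappa>) v)"
      by (subst sum.lessThan_Suc_shift) simp
    also have "(\<Sum>\<kappa><Suc (r i). b i j \<kappa> * out j \<kappa> v) = (\<Sum>\<kappa><r i. b i j \<kappa> * out j \<kappa> v)"
      using b_zero[OF i j, of "r i"] by simp
    finally show ?thesis by simp
  qed
  have "out i (Suc (r i)) v = (\<Sum>j<p. \<Sum>\<kappa><r i. b i j \<kappa> * out j (Suc \<kappa>) v) + v $ (n + i)"
    using out_r[OF Av i] A_last[OF v i] by (simp only: out_mult[OF v])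
  also have "\<dots> = (\<Sum>j<p. \<Sum>\<kappa><Suc (r i). d i j \<kappa> * out j \<kappa> v)"
    using out_r[OF v i] i by (simp add: d_sum sum.distrib sum_subtractf del: sum.lessThan_Suc)
  finally show ?thesis .
qed

section \<open>Three identities for the observer coordinates\<close>

lemma sum_coord:
  assumes v: "v \<in> carrier_vec (n + p)" and i: "i < p"
  shows "(\<Sum>s\<le>r i. coord i s v) = v $ (n + i)"
proof -
  \<comment> \<open>Being differences of the \<open>b\<close> coefficients, the \<open>d\<close>
    coefficients telescope; the last index \<open>r i\<close> supplies the Kronecker term.\<close>
  have d_tail: "(\<Sum>s\<in>{t<..r i}. d i j (r i + 1 + t - s)) = b i j t + (if i = j then 1 else 0)"
    if j: "j < p" and t: "t < r i" for j t
  proof -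
    have "(\<Sum>s\<in>{t<..r i}. d i j (r i + 1 + t - s)) = (\<Sum>\<kappa>\<in>{Suc t..r i}. d i j \<kappa>)"
      by (rule sum.reindex_bij_witness[of _ "\<lambda>s. r i + 1 + t - s" "\<lambda>s. r i + 1 + t - s"]) auto
    also have "(\<Sum>\<kappa>\<in>{Suc t..r i}. d i j \<kappa>) =
        (\<Sum>\<kappa>\<in>{Suc t..r i}. b i j (\<kappa> - 1) - b i j \<kappa>) + (\<Sum>\<kappa>\<in>{Suc t..r i}. if \<kappa> = r i then (if i = j then 1 else 0) else 0)"
      unfolding sum.distrib[symmetric] by (intro sum.cong) (auto simp: d_coeff_def)
    also have "(\<Sum>\<kappa>\<in>{Suc t..r i}. b i j (\<kappa> - 1) - b i j \<kappa>) = b i j t - b i j (r i)"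
    proof -
      have "(\<Sum>\<kappa>\<in>{Suc t..r i}. b i j \<kappa> - b i j (\<kappa> - 1)) = b i j (r i) - b i j t"
        using t by (intro sum_telescope'') simp
      then show ?thesis by (simp add: sum_subtractf)
    qed
    finally show ?thesis using b_zero[OF i j, of "r i"] t by simp
  qed
  have "(\<Sum>s\<le>r i. \<Sum>j<p. \<Sum>t<s. d i j (r i + 1 + t - s) * out j t v)
      = (\<Sum>j<p. \<Sum>s\<le>r i. \<Sum>t<s. d i j (r i + 1 + t - s) * out j t v)"
    by (rule sum.swap)
  \<comment> \<open>Interchange of summation over the triangle \<open>t < s \<le> r i\<close>, to
    collect for each output functional the tail evaluated in \<open>d_tail\<close>.\<close>
  also have "\<dots> = (\<Sum>j<p. \<Sum>t<r i. \<Sum>s\<in>{t<..r i}. d i j (r i + 1 + t - s) * out j t v)"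
    by (rule sum.cong[OF refl], subst (1 2) sum.Sigma) (auto intro!: sum.reindex_bij_witness[of _ prod.swap prod.swap])
  also have "\<dots> = (\<Sum>j<p. \<Sum>t<r i. (b i j t + (if i = j then 1 else 0)) * out j t v)"
    unfolding sum_distrib_right[symmetric] by (intro sum.cong refl) (simp only: d_tail lessThan_iff)
  also have "\<dots> = (\<Sum>j<p. \<Sum>t<r i. b i j t * out j t v) + (\<Sum>j<p. if i = j then (\<Sum>t<r i. out j t v) else 0)"
    unfolding sum.distrib[symmetric] by (intro sum.cong refl) (auto simp: algebra_simps sum.distrib)
  also have "(\<Sum>j<p. if i = j then (\<Sum>t<r i. out j t v) else 0) = (\<Sum>t<r i. out i t v)"
    using i by simp
  finally have "(\<Sum>s\<le>r i. coord i s v) = (\<Sum>s\<le>r i. out i s v)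
      - ((\<Sum>j<p. \<Sum>t<r i. b i j t * out j t v) + (\<Sum>t<r i. out i t v))"
    by (simp add: coord_def sum_subtractf)
  moreover have "(\<Sum>s\<le>r i. out i s v) = (\<Sum>t<r i. out i t v) + out i (r i) v"
    by (simp add: lessThan_Suc_atMost[symmetric])
  ultimately show ?thesis by (simp add: out_r[OF v i])
qed

text \<open>Raising every output index by one turns \<open>coord i s\<close> into
  \<open>coord i (Suc s)\<close> except for the missing term \<open>t = 0\<close>, which involves
  only current outputs and can thus be absorbed by output injection.\<close>

lemma coord_mult:
  assumes v: "v \<in> carrier_vec (n + p)" and i: "i < p" and s: "s \<le> r i"
  shows "coord i s (A *\<^sub>v v) = (if s = r i then 0 else coord i (Suc s) v) + (\<Sum>j<p. d i j (r i - s) * out j 0 v)"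
proof -
  have "(\<Sum>t<Suc s. d i j (r i + 1 + t - Suc s) * out j t v)
      = d i j (r i - s) * out j 0 v + (\<Sum>t<s. d i j (r i + 1 + t - s) * out j (Suc t) v)" for j
    by (subst sum.lessThan_Suc_shift) simp
  then have "coord i s (A *\<^sub>v v) = out i (Suc s) v - (\<Sum>j<p. \<Sum>t<Suc s. d i j (r i + 1 + t - Suc s) * out j t v)
      + (\<Sum>j<p. d i j (r i - s) * out j 0 v)"
    by (simp add: coord_def out_mult[OF v] sum.distrib del: sum.lessThan_Suc)
  then have "coord i s (A *\<^sub>v v) = coord i (Suc s) v + (\<Sum>j<p. d i j (r i - s) * out j 0 v)"
    by (simp only: coord_def)
  \<comment> \<open>The formula continued one position past the end of the block is precisely the
    relation \<open>out_Suc_r\<close>.\<close>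
  moreover have "coord i (Suc (r i)) v = 0"
    using out_Suc_r[OF v i] by (simp add: coord_def del: sum.lessThan_Suc)
  ultimately show ?thesis using s by auto
qed

text \<open>Every correction term vanishes: either \<open>t + q < r j\<close> and output
  \<open>j\<close> has not responded yet, or the index of its coefficient exceeds
  \<open>r j\<close>. Only the leading term \<open>out i (s + q)\<close> remains.\<close>

lemma coord_pow_disturbance:
  assumes w: "w \<in> carrier_vec p" and i: "i < p" and sq: "s + q \<le> r i"
  shows "coord i s (A ^\<^sub>m q *\<^sub>v (0\<^sub>v n @\<^sub>v w)) = (if s + q = r i then w $ i else 0)"
proof -
  have v: "0\<^sub>v n @\<^sub>v w \<in> carrier_vec (n + p)" using w by simp
  have corr: "d i j (r i + 1 + t - s) * out j (t + q) (0\<^sub>v n @\<^sub>v w) = 0" if "j < p" "t < s" for j t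
  proof (cases "t + q < r j")
    case True then show ?thesis using out_zero_append[OF w that(1), of "t + q"] by simp
  next
    case False then show ?thesis using d_zero[OF i that(1), of "r i + 1 + t - s"] sq that by simp
  qed
  have "(\<Sum>j<p. \<Sum>t<s. d i j (r i + 1 + t - s) * out j (t + q) (0\<^sub>v n @\<^sub>v w)) = 0"
    by (intro sum.neutral ballI corr) auto
  then show ?thesis by (simp only: coord_def out_pow[OF v] out_zero_append[OF w i sq] diff_zero)
qed

section \<open>The coordinate matrix and its invertibility\<close>

lemma Q_carrier: "Q_mat n p r b \<in> carrier_mat (n + p) (n + p)"
  by (simp add: Q_mat_def)

lemma S_carrier: "S_mat n p r A Cbb \<in> carrier_mat (n + p) (n + p)"
  by (rule carrier_matI) (simp_all add: S_mat_def length_index)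

lemma T_carrier: "T \<in> carrier_mat (n + p) (n + p)"
  unfolding T_mat_def by (rule mult_carrier_mat[OF Q_carrier S_carrier])

lemma S_index:
  assumes v: "v \<in> carrier_vec (n + p)" and q: "q < n + p" and qi: "block_index p r ! q = (i, s)"
  shows "(S_mat n p r A Cbb *\<^sub>v v) $ q = out i s v"
proof -
  let ?M = "\<lambda>\<kappa>. aug_C p Cbb * A ^\<^sub>m \<kappa>"
  have i: "i < p" using block_index_nth_mem[of q p r i s] q qi by (simp add: length_index)
  have M: "?M s \<in> carrier_mat p (n + p)" by (rule mult_carrier_mat[OF aug_C[OF Cbb] A_pow])
  have "row (?M s) i \<in> carrier_vec (n + p)"
    using row_carrier[of "?M s" i] carrier_matD(2)[OF M] by metis
  then have "row (S_mat n p r A Cbb) q = row (?M s) i"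
    unfolding S_mat_def using q qi by (subst mat_of_rows_row) (auto simp: length_index)
  then have "(S_mat n p r A Cbb *\<^sub>v v) $ q = (?M s *\<^sub>v v) $ i"
    using q i by (simp only: index_mult_mat_vec carrier_matD[OF S_carrier] carrier_matD[OF M])
  then show ?thesis by (simp only: out_def assoc_mult_mat_vec[OF aug_C[OF Cbb] A_pow v])
qed

lemma T_index:
  assumes v: "v \<in> carrier_vec (n + p)" and q: "q < n + p" and qi: "block_index p r ! q = (i, s)"
  shows "(T *\<^sub>v v) $ q = coord i s v"
proof -
  let ?Q = "Q_mat n p r b" and ?S = "S_mat n p r A Cbb"
  have i_s: "i < p" "s \<le> r i" using block_index_nth_mem[of q p r i s] q qi by (simp_all add: length_index)
  let ?g = "\<lambda>(j, t). ((if i = j \<and> s = t then 1 else 0)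
        - (if t < s then d i j (r i + 1 + t - s) else 0)) * out j t v"
  have "(T *\<^sub>v v) $ q = (?Q *\<^sub>v (?S *\<^sub>v v)) $ q"
    unfolding T_mat_def by (simp only: assoc_mult_mat_vec[OF Q_carrier S_carrier v])
  also have "\<dots> = (\<Sum>q2<n + p. ?Q $$ (q, q2) * (?S *\<^sub>v v) $ q2)"
    using Q_carrier S_carrier q by (simp add: scalar_prod_def lessThan_atLeast0)
  also have "\<dots> = (\<Sum>q2<n + p. ?g (block_index p r ! q2))"
  proof (intro sum.cong refl)
    fix q2 assume "q2 \<in> {..<n + p}"
    moreover obtain j t where "block_index p r ! q2 = (j, t)" by fastforce
    ultimately show "?Q $$ (q, q2) * (?S *\<^sub>v v) $ q2 = ?g (block_index p r ! q2)"
      using S_index[OF v, of q2 j t] q qi by (simp add: Q_mat_def del: index_mult_mat_vec)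
  qed
  also have "\<dots> = (\<Sum>j<p. \<Sum>t\<le>r j. ?g (j, t))"
    using sum_block_index[of ?g p r] by (simp only: length_index)
  also have "\<dots> = (\<Sum>j<p. (if i = j then out i s v else 0) - (\<Sum>t<s. d i j (r i + 1 + t - s) * out j t v))"
  proof (intro sum.cong refl)
    fix j assume "j \<in> {..<p}"
    then have j: "j < p" by simp
    have "(\<Sum>t\<le>r j. ?g (j, t)) = (\<Sum>t\<le>r j. if t = s then (if i = j then out j t v else 0) else 0)
        - (\<Sum>t\<le>r j. if t < s then d i j (r i + 1 + t - s) * out j t v else 0)"
      unfolding sum_subtractf[symmetric] by (intro sum.cong refl) auto
    also have "(\<Sum>t\<le>r j. if t = s then (if i = j then out j t v else 0) else 0) = (if i = j then out i s v else 0)"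
      using i_s by auto
    also have "(\<Sum>t\<le>r j. if t < s then d i j (r i + 1 + t - s) * out j t v else 0)
        = (\<Sum>t<s. d i j (r i + 1 + t - s) * out j t v)"
    \<comment> \<open>The ranges \<open>t \<le> r j\<close> and \<open>t < s\<close> may differ in
      either direction: the conditional handles \<open>t \<ge> s\<close>, and \<open>d_zero\<close>
      handles \<open>t > r j\<close>.\<close>
    proof (rule sum.mono_neutral_cong)
      fix t assume "t \<in> {..<s} - {..r j}"
      then have "r j < r i + 1 + t - s" using i_s(2) by auto
      then show "d i j (r i + 1 + t - s) * out j t v = 0" using d_zero[OF i_s(1) j] by simp
    qed auto
    finally show "(\<Sum>t\<le>r j. ?g (j, t))
        = (if i = j then out i s v else 0) - (\<Sum>t<s. d i j (r i + 1 + t - s) * out j t v)" .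
  qed
  also have "\<dots> = coord i s v" using i_s(1) by (simp add: coord_def sum_subtractf)
  finally show ?thesis .
qed

lemma index_cases:
  assumes "q < n + p"
  obtains i s where "block_index p r ! q = (i, s)" "i < p" "s \<le> r i"
  using block_index_nth_mem[of q p r] assms by (cases "block_index p r ! q") (auto simp: length_index)

lemma index_obtain:
  assumes "i < p" "s \<le> r i"
  obtains q where "q < n + p" "block_index p r ! q = (i, s)"
  using block_index_obtain[of i p s r] assms by (auto simp: length_index)

lemma index_inj:
  "\<lbrakk>q1 < n + p; q2 < n + p; block_index p r ! q1 = block_index p r ! q2\<rbrakk> \<Longrightarrow> q1 = q2"
  using nth_eq_iff_index_eq[OF distinct_block_index] by (simp add: length_index)

text \<open>A vector \<open>w\<close> in the left kernel is tested against propagated unit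
  disturbances. By \<open>coord_pow_disturbance\<close> these tests form a triangular system when
  the rows are ordered by their distance \<open>r i - s\<close> from the end of their block, so
  \<open>w = 0\<close>.\<close>

lemma T_det: "det T \<noteq> 0"
proof
  assume "det T = 0"
  then have "det (transpose_mat T) = 0" using det_transpose[OF T_carrier] by simp
  then obtain w where w: "w \<in> carrier_vec (n + p)" "w \<noteq> 0\<^sub>v (n + p)"
    and Tw: "transpose_mat T *\<^sub>v w = 0\<^sub>v (n + p)"
    using det_0_iff_vec_prod_zero[of "transpose_mat T" "n + p"] T_carrier by auto
  have ortho: "(\<Sum>q<n + p. w $ q * (T *\<^sub>v v) $ q) = 0" if v: "v \<in> carrier_vec (n + p)" for v
  proof -
    have "(\<Sum>q<n + p. w $ q * (T *\<^sub>v v) $ q) = w \<bullet> (T *\<^sub>v v)"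
      using T_carrier by (simp add: scalar_prod_def lessThan_atLeast0)
    also have "\<dots> = (transpose_mat T *\<^sub>v w) \<bullet> v"
      by (rule transpose_vec_mult_scalar[OF T_carrier v w(1), symmetric])
    finally show ?thesis using Tw v by simp
  qed
  have "w $ q = 0" if "q < n + p" "block_index p r ! q = (i, s)" "\<rho> = r i - s" for q i s \<rho>
    using that
  proof (induction \<rho> arbitrary: q i s rule: less_induct)
    case (less \<rho>)
    have i_s: "i < p" "s \<le> r i" using index_cases[OF less.prems(1)] less.prems(2) by auto
    let ?u = "unit_vec p i :: real vec"
    let ?v = "A ^\<^sub>m \<rho> *\<^sub>v (0\<^sub>v n @\<^sub>v ?u)"
    have u: "?u \<in> carrier_vec p" by simp
    have v: "?v \<in> carrier_vec (n + p)" by (rule A_pow_vec) simp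
    have other: "w $ q2 * (T *\<^sub>v ?v) $ q2 = 0" if q2: "q2 \<in> {..<n + p} - {q}" for q2
    proof -
      from q2 have q2: "q2 < n + p" "q2 \<noteq> q" by auto
      obtain j t where jt: "block_index p r ! q2 = (j, t)" "j < p" "t \<le> r j" by (rule index_cases[OF q2(1)])
      show ?thesis
      \<comment> \<open>Rows closer to the end of their block have zero weight by induction. For all
        others \<open>t + \<rho> \<le> r j\<close>, so only row \<open>(i, s)\<close> detects the
        test vector.\<close>
      proof (cases "r j - t < \<rho>")
        case True then show ?thesis using less.IH[OF True q2(1) jt(1)] by simp
      next
        case False
        have "\<not> (t + \<rho> = r j \<and> j = i)"
        proof
          assume "t + \<rho> = r j \<and> j = i"
          then have "t + (r i - s) = r i" "j = i" using less.prems(3) by auto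
          then have "t = s" "j = i" using i_s(2) by auto
          then show False using index_inj[OF q2(1) less.prems(1)] q2(2) jt(1) less.prems(2) by simp
        qed
        then have "coord j t ?v = 0"
          using coord_pow_disturbance[OF u jt(2), of t \<rho>] False jt i_s by (auto simp: unit_vec_def)
        then show ?thesis using T_index[OF v q2(1) jt(1)] by (simp del: index_mult_mat_vec)
      qed
    qed
    have "(\<Sum>q2\<in>{..<n + p} - {q}. w $ q2 * (T *\<^sub>v ?v) $ q2) = 0"
      by (intro sum.neutral ballI other)
    then have "(\<Sum>q<n + p. w $ q * (T *\<^sub>v ?v) $ q) = w $ q * (T *\<^sub>v ?v) $ q"
      using less.prems(1) by (subst sum.remove[of _ q]) (simp_all del: index_mult_mat_vec)
    moreover have "(T *\<^sub>v ?v) $ q = 1"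
      using T_index[OF v less.prems(1,2)] coord_pow_disturbance[OF u i_s(1), of s \<rho>] i_s less.prems(3)
      by (simp add: unit_vec_def del: index_mult_mat_vec)
    ultimately show "w $ q = 0" using ortho[OF v] by simp
  qed
  then have "w = 0\<^sub>v (n + p)"
    using w(1) by (intro eq_vecI) (metis index_cases carrier_vecD index_zero_vec)+
  then show False using w(2) by simp
qed

lemmas minv_T = minv_det_nonzero[OF T_carrier T_det]

text \<open>\<open>Cbb\<close> arises from \<open>C0\<close> by a unit lower triangular
  transformation, so the original outputs vanish by forward substitution.\<close>

lemma C_zero:
  assumes v: "v \<in> carrier_vec (n + p)" and zero: "\<And>j. j < p \<Longrightarrow> coord j 0 v = 0"
  shows "C *\<^sub>v v = 0\<^sub>v p"
proof -
  define x where "x = vec_first v n"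
  have x: "x \<in> carrier_vec n" by (simp add: x_def)
  have aug: "aug_C p M *\<^sub>v v = M *\<^sub>v x" if "M \<in> carrier_mat p n" for M
    using aug_C_append[OF that x, of "vec_last v p"] v by (simp add: x_def)
  have "i < p \<Longrightarrow> (C0 *\<^sub>v x) $ i = 0" for i
  proof (induction i rule: less_induct)
    case (less i)
    have "(Cbb *\<^sub>v x) $ i = 0"
      using zero[OF less.prems] out_0[OF v, of i] by (simp add: coord_def aug[OF Cbb] del: index_mult_mat_vec)
    moreover have "(\<Sum>j<i. a i j (r i) * (C0 *\<^sub>v x) $ j) = 0"
      using less by (intro sum.neutral) (simp del: index_mult_mat_vec)
    ultimately show ?case using Cbb_mult[OF x less.prems] by simp
  qed
  then show ?thesis unfolding aug[OF C0] using C0 by (intro eq_vecI) auto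
qed

section \<open>The closed loop and its decoupled subsystems\<close>

lemma closed_loop_carrier:
  assumes L: "L \<in> carrier_mat (n + p) p"
  shows "A - L * C \<in> carrier_mat (n + p) (n + p)"
  using L aug_C[OF C0] by (intro minus_carrier_mat) simp

lemma closed_loop_vec:
  assumes L: "L \<in> carrier_mat (n + p) p" and v: "v \<in> carrier_vec (n + p)"
  shows "(A - L * C) *\<^sub>v v = A *\<^sub>v v - L *\<^sub>v (C *\<^sub>v v)"
  using minus_mult_distrib_mat_vec[OF A mult_carrier_mat[OF L aug_C[OF C0]] v]
    assoc_mult_mat_vec[OF L aug_C[OF C0] v] by simp

context
  fixes L :: "real mat" and Ns :: "real mat list"
  assumes L: "L \<in> carrier_mat (n + p) p" and dec: "decoupled p r A C L T Ns"
begin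

lemma Ns: "length Ns = p" "i < p \<Longrightarrow> Ns ! i \<in> carrier_mat (r i + 1) (r i + 1)"
  using dec by (auto simp: decoupled_def)

lemma diag_block_carrier: "diag_block_mat Ns \<in> carrier_mat (n + p) (n + p)"
  using diag_block_mat_index(1)[OF Ns] by (simp add: length_index)

text \<open>The decoupling condition as an intertwining relation, free of the inverse of
  \<open>T\<close>.\<close>

lemma diag_block_T:
  assumes v: "v \<in> carrier_vec (n + p)"
  shows "diag_block_mat Ns *\<^sub>v (T *\<^sub>v v) = T *\<^sub>v ((A - L * C) *\<^sub>v v)"
proof -
  let ?K = "A - L * C"
  have Tv: "T *\<^sub>v v \<in> carrier_vec (n + p)" by (rule mult_mat_vec_carrier[OF T_carrier v])
  have TK: "T * ?K \<in> carrier_mat (n + p) (n + p)"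
    by (rule mult_carrier_mat[OF T_carrier closed_loop_carrier[OF L]])
  have "diag_block_mat Ns *\<^sub>v (T *\<^sub>v v) = (T * ?K * minv T) *\<^sub>v (T *\<^sub>v v)"
    using dec by (simp only: decoupled_def)
  also have "\<dots> = (T * ?K) *\<^sub>v (minv T *\<^sub>v (T *\<^sub>v v))"
    by (rule assoc_mult_mat_vec[OF TK minv_T(1) Tv])
  also have "minv T *\<^sub>v (T *\<^sub>v v) = v"
    using assoc_mult_mat_vec[OF minv_T(1) T_carrier v] v by (simp only: minv_T(3) one_mult_mat_vec)
  also have "(T * ?K) *\<^sub>v v = T *\<^sub>v (?K *\<^sub>v v)"
    by (rule assoc_mult_mat_vec[OF T_carrier closed_loop_carrier[OF L] v])
  finally show ?thesis .
qed

text \<open>Output injection vanishes on states whose first coordinate in every block is zero, and there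
  the plant acts as a pure shift.\<close>

lemma Ns_shift:
  assumes i: "i < p" and s: "s \<le> r i" and t: "1 \<le> t" "t \<le> r i"
  shows "Ns ! i $$ (s, t) = (if s + 1 = t then 1 else 0)"
proof -
  obtain q1 where q1: "q1 < n + p" "block_index p r ! q1 = (i, s)" using i s by (rule index_obtain)
  obtain q2 where q2: "q2 < n + p" "block_index p r ! q2 = (i, t)" using i t(2) by (rule index_obtain)
  let ?u = "unit_vec (n + p) q2 :: real vec"
  \<comment> \<open>The state with observer coordinates equal to the unit vector at
    \<open>(i, t)\<close>; applying the closed loop to it reads off that column of the
    block.\<close>
  define v where "v = minv T *\<^sub>v ?u"
  have u: "?u \<in> carrier_vec (n + p)" by simp
  have v: "v \<in> carrier_vec (n + p)" unfolding v_def by (rule mult_mat_vec_carrier[OF minv_T(1) u])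
  have Av: "A *\<^sub>v v \<in> carrier_vec (n + p)" by (rule mult_mat_vec_carrier[OF A v])
  have Tv: "T *\<^sub>v v = ?u"
    unfolding v_def using assoc_mult_mat_vec[OF T_carrier minv_T(1) u] by (simp only: minv_T(2) one_mult_mat_vec[OF u])
  have coord_v: "coord j \<kappa> v = (if j = i \<and> \<kappa> = t then 1 else 0)" if jk: "j < p" "\<kappa> \<le> r j" for j \<kappa>
  proof -
    obtain q where q: "q < n + p" "block_index p r ! q = (j, \<kappa>)" using jk by (rule index_obtain)
    have "coord j \<kappa> v = ?u $ q" using T_index[OF v q] by (simp only: Tv)
    then show ?thesis using q q2 index_inj[OF q(1) q2(1)] by auto
  qed
  \<comment> \<open>Here \<open>1 \<le> t\<close> matters: the only nonzero coordinate of
    \<open>v\<close> is not the first of its block.\<close>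
  have C_v: "C *\<^sub>v v = 0\<^sub>v p" using t by (intro C_zero[OF v]) (simp add: coord_v)
  have "Ns ! i $$ (s, t) = diag_block_mat Ns $$ (q1, q2)"
    using diag_block_mat_index(2)[OF Ns, of q1 q2 i s i t] q1 q2 by (simp add: length_index)
  also have "\<dots> = (diag_block_mat Ns *\<^sub>v (T *\<^sub>v v)) $ q1"
    unfolding Tv using diag_block_carrier q1(1) q2(1) by (simp add: scalar_prod_right_unit)
  also have "\<dots> = (T *\<^sub>v (A *\<^sub>v v)) $ q1"
    unfolding diag_block_T[OF v] closed_loop_vec[OF L v] C_v mult_mat_zero_vec[OF L] using Av by simp
  also have "\<dots> = coord i s (A *\<^sub>v v)" by (rule T_index[OF Av q1])
  also have "\<dots> = (if s = r i then 0 else coord i (Suc s) v)"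
  proof -
    have "out j 0 v = 0" if j: "j < p" for j using coord_v[OF j, of 0] t(1) by (simp add: coord_def)
    then have "(\<Sum>j<p. d i j (r i - s) * out j 0 v) = 0" by (intro sum.neutral) simp
    then show ?thesis by (simp only: coord_mult[OF v i s] add_0_right)
  qed
  also have "\<dots> = (if s + 1 = t then 1 else 0)" using coord_v[OF i, of "Suc s"] s t by auto
  finally show ?thesis .
qed

text \<open>The increment enters block \<open>i\<close> only at its last coordinate
  (\<open>coord_pow_disturbance\<close> with \<open>q = 0\<close>), the blocks evolve separately,
  and \<open>sum_coord\<close> reads the disturbance error as the coordinate sum.\<close>

lemma error_response:
  assumes e0: "e 0 = 0\<^sub>v (n + p)"
    and step: "\<And>k. e (Suc k) = (A - L * C) *\<^sub>v e k + (0\<^sub>v n @\<^sub>v c k)"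
    and c: "\<And>k. c k \<in> carrier_vec p" and i: "i < p"
  shows "e k $ (n + i) = (\<Sum>l<k. c l $ i *
      (vec (r i + 1) (\<lambda>_. 1) \<bullet> ((Ns ! i) ^\<^sub>m (k - 1 - l) *\<^sub>v unit_vec (r i + 1) (r i))))"
proof -
  have e: "e k \<in> carrier_vec (n + p)" for k
    by (induction k) (simp_all add: e0 step c mult_mat_vec_carrier[OF closed_loop_carrier[OF L]] del: mult_mat_vec_carrier)
  define z where "z k = vec (r i + 1) (\<lambda>s. coord i s (e k))" for k
  have z0: "z 0 = 0\<^sub>v (r i + 1)"
  proof (rule eq_vecI)
    fix s assume "s < dim_vec (0\<^sub>v (r i + 1) :: real vec)"
    then have s: "s < r i + 1" "s \<le> r i" by auto
    obtain q where q: "q < n + p" "block_index p r ! q = (i, s)" using i s(2) by (rule index_obtain)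
    have "coord i s (e 0) = (T *\<^sub>v e 0) $ q" by (rule T_index[OF e q, symmetric])
    also have "\<dots> = 0" unfolding e0 mult_mat_zero_vec[OF T_carrier] using q by simp
    finally show "z 0 $ s = 0\<^sub>v (r i + 1) $ s" using s by (simp add: z_def)
  qed (simp add: z_def)
  have z_step: "z (Suc k) = Ns ! i *\<^sub>v z k + (c k $ i) \<cdot>\<^sub>v unit_vec (r i + 1) (r i)" for k
  proof (rule eq_vecI)
    fix s assume "s < dim_vec (Ns ! i *\<^sub>v z k + (c k $ i) \<cdot>\<^sub>v unit_vec (r i + 1) (r i))"
    then have s: "s < r i + 1" "s \<le> r i" by auto
    obtain q where q: "q < n + p" "block_index p r ! q = (i, s)" using i s(2) by (rule index_obtain)
    have Te: "T *\<^sub>v e k \<in> carrier_vec (n + p)" by (rule mult_mat_vec_carrier[OF T_carrier e])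
    have Ke: "(A - L * C) *\<^sub>v e k \<in> carrier_vec (n + p)" by (rule mult_mat_vec_carrier[OF closed_loop_carrier[OF L] e])
    have cv: "0\<^sub>v n @\<^sub>v c k \<in> carrier_vec (n + p)" using c by simp
    let ?g = "\<lambda>(j, t). (if i = j then Ns ! i $$ (s, t) else 0) * coord j t (e k)"
    have "coord i s (e (Suc k)) = (T *\<^sub>v e (Suc k)) $ q" by (rule T_index[OF e q, symmetric])
    also have "\<dots> = (diag_block_mat Ns *\<^sub>v (T *\<^sub>v e k)) $ q + (T *\<^sub>v (0\<^sub>v n @\<^sub>v c k)) $ q"
      unfolding step mult_add_distrib_mat_vec[OF T_carrier Ke cv] diag_block_T[OF e]
      using q T_carrier by (simp del: index_mult_mat_vec)
    also have "(T *\<^sub>v (0\<^sub>v n @\<^sub>v c k)) $ q = (if s = r i then c k $ i else 0)"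
      using T_index[OF cv q] coord_pow_disturbance[OF c i, of s 0 k] s A cv by (simp del: index_mult_mat_vec)
    also have "(diag_block_mat Ns *\<^sub>v (T *\<^sub>v e k)) $ q
        = (\<Sum>q2<n + p. diag_block_mat Ns $$ (q, q2) * (T *\<^sub>v e k) $ q2)"
      using diag_block_carrier T_carrier q by (simp add: scalar_prod_def lessThan_atLeast0)
    also have "\<dots> = (\<Sum>q2<n + p. ?g (block_index p r ! q2))"
    proof (intro sum.cong refl)
      fix q2 assume "q2 \<in> {..<n + p}"
      moreover obtain j t where "block_index p r ! q2 = (j, t)" by fastforce
      ultimately show "diag_block_mat Ns $$ (q, q2) * (T *\<^sub>v e k) $ q2 = ?g (block_index p r ! q2)"
        using T_index[OF e, of q2 j t k] diag_block_mat_index(2)[OF Ns, of q q2 i s j t] q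
        by (simp add: length_index del: index_mult_mat_vec)
    qed
    also have "\<dots> = (\<Sum>j<p. \<Sum>t\<le>r j. ?g (j, t))"
      using sum_block_index[of ?g p r] by (simp only: length_index)
    also have "\<dots> = (\<Sum>j<p. if i = j then (\<Sum>t\<le>r i. Ns ! i $$ (s, t) * coord i t (e k)) else 0)"
      by (intro sum.cong refl) auto
    also have "\<dots> = (\<Sum>t\<le>r i. Ns ! i $$ (s, t) * coord i t (e k))" using i by simp
    also have "\<dots> = (Ns ! i *\<^sub>v z k) $ s"
      using Ns(2)[OF i] s by (simp add: z_def scalar_prod_def atMost_atLeast0 atLeastLessThanSuc_atLeastAtMost)
    finally have "coord i s (e (Suc k)) = (Ns ! i *\<^sub>v z k) $ s + (if s = r i then c k $ i else 0)" .
    then show "z (Suc k) $ s = (Ns ! i *\<^sub>v z k + (c k $ i) \<cdot>\<^sub>v unit_vec (r i + 1) (r i)) $ s"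
      using s Ns(2)[OF i] by (simp add: z_def[of "Suc k"] unit_vec_def del: index_mult_mat_vec)
  qed (use Ns(2)[OF i] in \<open>simp add: z_def\<close>)
  have "e k $ (n + i) = (\<Sum>s\<le>r i. coord i s (e k))" by (rule sum_coord[OF e i, symmetric])
  also have "\<dots> = vec (r i + 1) (\<lambda>_. 1) \<bullet> z k"
    by (simp add: z_def scalar_prod_def atMost_atLeast0 atLeastLessThanSuc_atLeastAtMost)
  also have "\<dots> = (\<Sum>l<k. c l $ i *
      (vec (r i + 1) (\<lambda>_. 1) \<bullet> ((Ns ! i) ^\<^sub>m (k - 1 - l) *\<^sub>v unit_vec (r i + 1) (r i))))"
    by (rule linear_recurrence_convolution[OF Ns(2)[OF i]]) (simp_all add: z0 z_step)
  finally show ?thesis .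
qed

end
end

text \<open>The plateau \<open>q \<le> ri\<close> of the response corresponds exactly to arguments
  up to \<open>rmax + 1\<close>, where the two branches of \<open>h_new\<close> meet.\<close>

lemma h_new_impulse_response:
  fixes N :: "real mat"
  assumes "N \<in> carrier_mat (ri + 1) (ri + 1)" "all_eigenvalues_at N \<omega>"
    and "\<And>s t. \<lbrakk>s \<le> ri; 1 \<le> t; t \<le> ri\<rbrakk> \<Longrightarrow> N $$ (s, t) = (if s + 1 = t then 1 else 0)"
    and "ri \<le> rmax"
  shows "vec (ri + 1) (\<lambda>_. 1) \<bullet> (N ^\<^sub>m q *\<^sub>v unit_vec (ri + 1) ri) = h_new rmax ri \<omega> (q + (rmax - ri) + 1)"
proof (cases "q \<le> ri")
  case True
  then have "q + (rmax - ri) + 1 \<le> rmax + 1" using assms(4) by simp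
  then show ?thesis using shift_impulse_response(1)[OF assms(1-3) True] by (simp only: h_new_def if_True)
next
  case False
  then show ?thesis
    using shift_impulse_response(2)[OF assms(1-3), of q] h_new_shift[OF assms(4), of q \<omega>] by (simp only:)
qed

lemma mat_diag_mult_vec:
  fixes g :: "nat \<Rightarrow> 'a :: semiring_1"
  assumes "v \<in> carrier_vec p" "i < p"
  shows "(mat_diag p g *\<^sub>v v) $ i = g i * v $ i"
proof -
  have "(mat_diag p g *\<^sub>v v) $ i = (\<Sum>j = 0..<p. (if i = j then g j else 0) * v $ j)"
    using assms by (simp add: mat_diag_def scalar_prod_def)
  also have "\<dots> = (\<Sum>j = 0..<p. if j = i then g i * v $ i else 0)" by (intro sum.cong) auto
  finally show ?thesis using assms by simp
qed

section \<open>Estimation error\<close>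

theorem theorem4:
  fixes n m p rmax :: nat
    and r :: "nat \<Rightarrow> nat"
    and A0 B0 E0 C0 V0 A B C Cbb T L :: "real mat"
    and a b :: "nat \<Rightarrow> nat \<Rightarrow> nat \<Rightarrow> real"
    and Ns :: "real mat list"
    and \<omega> :: "nat \<Rightarrow> real"
    and x u f y f_new \<Delta>f_new xhat fhat :: "nat \<Rightarrow> real vec"
  assumes p_pos: "0 < p"
    and dims: "A0 \<in> carrier_mat n n" "B0 \<in> carrier_mat n m"
      "E0 \<in> carrier_mat n p" "C0 \<in> carrier_mat p n"
    and C0_full_row_rank: "vec_space.rank p C0 = p"
    and signals: "\<And>k. x k \<in> carrier_vec n" "\<And>k. u k \<in> carrier_vec m"
      "\<And>k. f k \<in> carrier_vec p"
    and plant: "\<And>k. x (k + 1) = A0 *\<^sub>v x k + B0 *\<^sub>v u k + E0 *\<^sub>v f k"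
      "\<And>k. y k = C0 *\<^sub>v x k"
    and rel_degree: "relative_degree_cond n p r A0 E0 C0"
    and rmax: "rmax = Max (r ` {..<p})"
    and V0: "V0 = gain_mat p r A0 E0 C0"
    and f_new: "\<And>k. f_new k = V0 *\<^sub>v f k"
    and \<Delta>f_new: "\<And>k. \<Delta>f_new k = f_new (k + 1) - f_new k"
    and augmented: "A = aug_A n p A0 E0 V0" "B = aug_B p m B0" "C = aug_C p C0"
    and coeffs_a: "output_coeffs n p r A0 C0 a"
    and Cbb: "Cbb = cbb_mat n p r C0 a"
    and coeffs_b: "canonical_coeffs n p r A0 Cbb b"
    and T: "T = T_mat n p r A Cbb b"
    and L: "L \<in> carrier_mat (n + p) p"
    and L_decoupled: "decoupled p r A C L T Ns"
    and L_eigenvalues: "\<And>i. i < p \<Longrightarrow> all_eigenvalues_at (Ns ! i) (\<omega> i)"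
    and \<omega>_stable: "\<And>i. i < p \<Longrightarrow> \<bar>\<omega> i\<bar> < 1"
    and observer_init: "xhat 0 = x 0 @\<^sub>v f_new 0"
    and observer: "\<And>k. xhat (k + 1) = A *\<^sub>v xhat k + B *\<^sub>v u k + L *\<^sub>v (y k - C *\<^sub>v xhat k)"
    and fhat: "\<And>k. Max ((\<lambda>i. rmax - r i) ` {..<p}) \<le> k \<Longrightarrow>
      fhat k = minv V0 *\<^sub>v vec p (\<lambda>i. xhat (k - (rmax - r i)) $ (n + i))"
  shows "\<forall>k \<ge> Max ((\<lambda>i. rmax - r i) ` {..<p}).
    f k - fhat k =
      minv V0 *\<^sub>v finsum_vec TYPE(real) p
        (\<lambda>l. mat_diag p (\<lambda>i. h_new rmax (r i) (\<omega> i) (k - l)) *\<^sub>v \<Delta>f_new l) {..<k}"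
proof -
  interpret sys: observer_form n p r A0 E0 C0 a b
    using dims rel_degree coeffs_a coeffs_b
    by unfold_locales (auto simp: output_coeffs_def Cbb)
  have A: "A \<in> carrier_mat (n + p) (n + p)" and C: "C \<in> carrier_mat p (n + p)"
    using sys.A sys.aug_C[OF dims(4)] by (simp_all add: augmented V0)
  have V0c: "V0 \<in> carrier_mat p p" using sys.V0 by (simp add: V0)
  have W: "minv V0 \<in> carrier_mat p p" "minv V0 * V0 = 1\<^sub>m p"
    using sys.minv_V0 by (simp_all add: V0)
  have dec: "decoupled p r (aug_A n p A0 E0 (gain_mat p r A0 E0 C0)) (aug_C p C0) L
      (T_mat n p r (aug_A n p A0 E0 (gain_mat p r A0 E0 C0)) (cbb_mat n p r C0 a) b) Ns"
    using L_decoupled by (simp add: augmented V0 T Cbb)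
  have fn: "f_new k \<in> carrier_vec p" for k
    unfolding f_new by (rule mult_mat_vec_carrier[OF V0c signals(3)])
  have \<Delta>: "\<Delta>f_new k \<in> carrier_vec p" for k using fn by (simp add: \<Delta>f_new)
  have Wf: "minv V0 *\<^sub>v f_new k = f k" for k
    unfolding f_new using assoc_mult_mat_vec[OF W(1) V0c signals(3)] signals(3) by (simp only: W(2) one_mult_mat_vec)
  have B: "B \<in> carrier_mat (n + p) m" unfolding augmented aug_B_def using dims(2) by auto
  \<comment> \<open>The true augmented state. It obeys the observer's model except for the increment
    of the disturbance, which therefore becomes the only input of the error.\<close>
  define xi where "xi k = x k @\<^sub>v f_new k" for k
  have xi: "xi k \<in> carrier_vec (n + p)" for k using signals(1) fn by (simp add: xi_def)
  have Cxi: "C *\<^sub>v xi k = y k" for k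
    unfolding xi_def augmented plant using sys.aug_C_append[OF dims(4) signals(1) fn] .
  have Bu: "B *\<^sub>v u k = (B0 *\<^sub>v u k) @\<^sub>v 0\<^sub>v p" for k
  proof -
    have "0\<^sub>m p m *\<^sub>v u k = 0\<^sub>v p" using signals(2) by (intro eq_vecI) auto
    then show ?thesis
      unfolding augmented aug_B_def using mat_mult_append[OF dims(2) zero_carrier_mat signals(2)] by simp
  qed
  have xi_step: "xi (Suc k) = A *\<^sub>v xi k + B *\<^sub>v u k + (0\<^sub>v n @\<^sub>v \<Delta>f_new k)" for k
  proof -
    have c: "A0 *\<^sub>v x k \<in> carrier_vec n" "B0 *\<^sub>v u k \<in> carrier_vec n" "E0 *\<^sub>v f k \<in> carrier_vec n"
      using dims signals by simp_all
    have add_swap: "v1 + v2 + v3 + 0\<^sub>v n = v1 + v3 + v2"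
      if "v1 \<in> carrier_vec n" "v2 \<in> carrier_vec n" "v3 \<in> carrier_vec n" for v1 v2 v3 :: "real vec"
      using that by (intro eq_vecI) auto
    have "A *\<^sub>v xi k = (A0 *\<^sub>v x k + E0 *\<^sub>v f k) @\<^sub>v f_new k"
      using sys.A_append[OF signals(1) fn] Wf by (simp add: xi_def augmented V0)
    then have "A *\<^sub>v xi k + B *\<^sub>v u k + (0\<^sub>v n @\<^sub>v \<Delta>f_new k)
        = (A0 *\<^sub>v x k + E0 *\<^sub>v f k + B0 *\<^sub>v u k + 0\<^sub>v n) @\<^sub>v (f_new k + 0\<^sub>v p + \<Delta>f_new k)"
      unfolding Bu using c fn[of k] \<Delta>[of k] by (simp add: append_vec_add[of _ n _ _ p])
    also have "A0 *\<^sub>v x k + E0 *\<^sub>v f k + B0 *\<^sub>v u k + 0\<^sub>v n = x (Suc k)"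
      using add_swap[OF c(1,3,2)] plant(1)[of k] by simp
    also have "f_new k + 0\<^sub>v p + \<Delta>f_new k = f_new (Suc k)"
      using fn[of k] fn[of "Suc k"] by (intro eq_vecI) (auto simp: \<Delta>f_new)
    finally show ?thesis by (simp add: xi_def)
  qed
  have xhat: "xhat k \<in> carrier_vec (n + p)" for k
  proof (induction k)
    case 0 then show ?case using xi[of 0] by (simp add: observer_init xi_def)
  next
    case (Suc k)
    have "y k \<in> carrier_vec p" unfolding Cxi[symmetric] by (rule mult_mat_vec_carrier[OF C xi])
    then have "L *\<^sub>v (y k - C *\<^sub>v xhat k) \<in> carrier_vec (n + p)"
      using C Suc by (intro mult_mat_vec_carrier[OF L]) simp
    then show ?case unfolding observer[of k, unfolded Suc_eq_plus1[symmetric]]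
      by (intro add_carrier_vec mult_mat_vec_carrier[OF A Suc] mult_mat_vec_carrier[OF B signals(2)])
  qed
  define e where "e k = xi k - xhat k" for k
  have e0: "e 0 = 0\<^sub>v (n + p)" using xi[of 0] by (simp add: e_def observer_init xi_def)
  have e_step: "e (Suc k) = (A - L * C) *\<^sub>v e k + (0\<^sub>v n @\<^sub>v \<Delta>f_new k)" for k
  proof -
    have e: "e k \<in> carrier_vec (n + p)" using xi[of k] xhat[of k] by (simp add: e_def)
    have "(A - L * C) *\<^sub>v e k = A *\<^sub>v e k - L *\<^sub>v (C *\<^sub>v e k)"
      using sys.closed_loop_vec[OF L e] by (simp add: augmented V0)
    also have "A *\<^sub>v e k = A *\<^sub>v xi k - A *\<^sub>v xhat k"
      unfolding e_def by (rule mult_minus_distrib_mat_vec[OF A xi xhat])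
    also have "C *\<^sub>v e k = y k - C *\<^sub>v xhat k"
      unfolding e_def mult_minus_distrib_mat_vec[OF C xi xhat] Cxi ..
    finally have K: "(A - L * C) *\<^sub>v e k = A *\<^sub>v xi k - A *\<^sub>v xhat k - L *\<^sub>v (y k - C *\<^sub>v xhat k)" .
    have cancel: "v1 + v2 + v3 - (v4 + v2 + v5) = v1 - v4 - v5 + v3"
      if "v1 \<in> carrier_vec d" "v2 \<in> carrier_vec d" "v3 \<in> carrier_vec d" "v4 \<in> carrier_vec d" "v5 \<in> carrier_vec d"
      for v1 v2 v3 v4 v5 :: "real vec" and d
      using that by (intro eq_vecI) auto
    have "y k - C *\<^sub>v xhat k \<in> carrier_vec p"
      using mult_mat_vec_carrier[OF C xi, of k] mult_mat_vec_carrier[OF C xhat, of k] by (simp only: Cxi minus_carrier_vec)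
    then show ?thesis
      unfolding K e_def[of "Suc k"] xi_step observer[of k, unfolded Suc_eq_plus1[symmetric]]
      using \<Delta>[of k]
      by (intro cancel[of _ "n + p"] mult_mat_vec_carrier[OF A] mult_mat_vec_carrier[OF B] mult_mat_vec_carrier[OF L]
          xi xhat signals(2)) simp_all
  qed
  have r_le: "r i \<le> rmax" if "i < p" for i using that by (simp add: rmax)
  have e_response: "e k $ (n + i) = (\<Sum>l<k. h_new rmax (r i) (\<omega> i) (k - 1 - l + (rmax - r i) + 1) * \<Delta>f_new l $ i)"
    if i: "i < p" for k i
  proof -
    have "e (Suc k) = (aug_A n p A0 E0 (gain_mat p r A0 E0 C0) - L * aug_C p C0) *\<^sub>v e k + (0\<^sub>v n @\<^sub>v \<Delta>f_new k)" for k
      using e_step by (simp add: augmented V0)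
    note resp = sys.error_response[OF L dec e0 this \<Delta> i, of k]
    show ?thesis unfolding resp
      using h_new_impulse_response[OF sys.Ns(2)[OF L dec i] L_eigenvalues[OF i] sys.Ns_shift[OF L dec i] r_le[OF i]]
      by (intro sum.cong refl) (simp only: mult.commute)
  qed
  show ?thesis
  proof (intro allI impI)
    fix k assume k: "Max ((\<lambda>i. rmax - r i) ` {..<p}) \<le> k"
    let ?g = "\<lambda>l. mat_diag p (\<lambda>i. h_new rmax (r i) (\<omega> i) (k - l)) *\<^sub>v \<Delta>f_new l"
    let ?fd = "vec p (\<lambda>i. xhat (k - (rmax - r i)) $ (n + i))"
    have g: "?g \<in> {..<k} \<rightarrow> carrier_vec p"
      by (intro Pi_I mult_mat_vec_carrier[OF mat_diag_dim] \<Delta>)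
    have "f_new k - ?fd = finsum_vec TYPE(real) p ?g {..<k}"
    proof (rule eq_vecI)
      fix i assume "i < dim_vec (finsum_vec TYPE(real) p ?g {..<k})"
      then have i: "i < p" using finsum_vec_closed[OF g] by auto
      \<comment> \<open>The alignment delay of channel \<open>i\<close>: at time \<open>k\<close>
        the estimate from time \<open>k - \<delta>\<close> is used.\<close>
      define \<delta> where "\<delta> = rmax - r i"
      have "\<delta> \<le> Max ((\<lambda>i. rmax - r i) ` {..<p})"
        unfolding \<delta>_def using i by (intro Max_ge) auto
      then have \<delta>: "\<delta> \<le> k" using k by (rule le_trans)
      have "finsum_vec TYPE(real) p ?g {..<k} $ i = (\<Sum>l<k. ?g l $ i)"
        by (rule index_finsum_vec[OF _ i g]) simp
      also have "\<dots> = (\<Sum>l<k. h_new rmax (r i) (\<omega> i) (k - l) * \<Delta>f_new l $ i)"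
        by (intro sum.cong refl) (rule mat_diag_mult_vec[OF \<Delta> i])
      \<comment> \<open>The increments before \<open>k - \<delta>\<close> make up the observer error
        at the delayed time. The remaining \<open>\<delta>\<close> increments have weight 1 and
        telescope to the change of the disturbance during the delay.\<close>
      also have "\<dots> = (\<Sum>l<k - \<delta>. h_new rmax (r i) (\<omega> i) (k - l) * \<Delta>f_new l $ i)
          + (\<Sum>l = k - \<delta>..<k. h_new rmax (r i) (\<omega> i) (k - l) * \<Delta>f_new l $ i)"
        using sum.atLeastLessThan_concat[of 0 "k - \<delta>" k "\<lambda>l. h_new rmax (r i) (\<omega> i) (k - l) * \<Delta>f_new l $ i"]
        by (simp add: lessThan_atLeast0)
      also have "(\<Sum>l<k - \<delta>. h_new rmax (r i) (\<omega> i) (k - l) * \<Delta>f_new l $ i) = e (k - \<delta>) $ (n + i)"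
        unfolding e_response[OF i]
      proof (intro sum.cong refl)
        fix l assume "l \<in> {..<k - \<delta>}"
        then have "k - l = k - \<delta> - 1 - l + (rmax - r i) + 1" by (auto simp: \<delta>_def)
        then show "h_new rmax (r i) (\<omega> i) (k - l) * \<Delta>f_new l $ i
          = h_new rmax (r i) (\<omega> i) (k - \<delta> - 1 - l + (rmax - r i) + 1) * \<Delta>f_new l $ i" by (simp only:)
      qed
      also have "\<dots> = f_new (k - \<delta>) $ i - xhat (k - \<delta>) $ (n + i)"
        using xi[of "k - \<delta>"] xhat[of "k - \<delta>"] signals(1)[of "k - \<delta>"] fn[of "k - \<delta>"] i
        by (simp add: e_def xi_def)
      also have "(\<Sum>l = k - \<delta>..<k. h_new rmax (r i) (\<omega> i) (k - l) * \<Delta>f_new l $ i)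
          = (\<Sum>l = k - \<delta>..<k. f_new (Suc l) $ i - f_new l $ i)"
      proof (intro sum.cong refl)
        fix l assume "l \<in> {k - \<delta>..<k}"
        \<comment> \<open>Since \<open>k - l \<le> \<delta> \<le> rmax\<close>, the first branch of
          \<open>h_new\<close> applies.\<close>
        then have "k - l \<le> rmax + 1" using \<delta> by (auto simp: \<delta>_def)
        then have "h_new rmax (r i) (\<omega> i) (k - l) = 1" by (simp only: h_new_def if_True)
        then show "h_new rmax (r i) (\<omega> i) (k - l) * \<Delta>f_new l $ i = f_new (Suc l) $ i - f_new l $ i"
          using fn[of l] fn[of "Suc l"] i by (simp add: \<Delta>f_new)
      qed
      also have "\<dots> = f_new k $ i - f_new (k - \<delta>) $ i" by (rule sum_Suc_diff') simp
      finally have "finsum_vec TYPE(real) p ?g {..<k} $ i = f_new k $ i - xhat (k - \<delta>) $ (n + i)" by simp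
      then show "(f_new k - ?fd) $ i = finsum_vec TYPE(real) p ?g {..<k} $ i"
        using i by (simp add: \<delta>_def)
    next
      show "dim_vec (f_new k - ?fd) = dim_vec (finsum_vec TYPE(real) p ?g {..<k})"
        using finsum_vec_closed[OF g] by auto
    qed
    moreover have "f k - fhat k = minv V0 *\<^sub>v (f_new k - ?fd)"
      unfolding fhat[OF k] using mult_minus_distrib_mat_vec[OF W(1) fn, of ?fd k] Wf by simp
    ultimately show "f k - fhat k = minv V0 *\<^sub>v finsum_vec TYPE(real) p ?g {..<k}" by simp
  qed
qed

end
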